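(* Let $p,q$ be positive integers, let $a\in M_{p\times q}(\mathbb N)$ be a matrix such that $\sum_{i,j}a_{ij}$ is even, and put $k=\frac12\sum_{i,j}a_{ij}$. For $n\ge\max(p,q)$ let $I(a)=\int_{O_n}\prod_{i=1}^p\prod_{j=1}^q u_{ij}^{a_{ij}}\,du$. Then, as $n\to\infty$, we have the estimate $$I(a)=n^{-k-e(a)}\left(\mu(a)+O(n^{-1})\right),$$ where $$e(a)=\min\{d(\pi,\sigma)\mid \pi,\sigma\in D_k,\ \delta_\pi(a_l)=\delta_\sigma(a_r)=1\},$$ and $\mu(a)$ is the signed count of all $a$-admissible paths in $D_k$ of total length $e(a)$, i.e. the number of such paths of signature $+$ minus the number of such paths of signature $-$.
   Context: $\mathbb N=\{0,1,2,\ldots\}$. $O_n$ is the group of real orthogonal $n\times n$ matrices $u=(u_{ij})$, and $du$ is its normalized (probability) Haar measure. A pairing of $\{1,\ldots,2k\}$ is a partition of this set into $k$ blocks of size $2$. For pairings $\pi,\sigma$, $\mathrm{loops}(\pi,\sigma)$ is the number of loops obtained by superposing $\pi$ and $\sigma$, i.e. the number of connected components of the multigraph on $\{1,\ldots,2k\}$ whose edges are the blocks of $\pi$ together with the blocks of $\sigma$. The Brauer space $D_k$ is the set of pairings of $\{1,\ldots,2k\}$ with the distance $d(\pi,\sigma)=k-\mathrm{loops}(\pi,\sigma)$. For a multi-index $i=(i_1,\ldots,i_{2k})$ and a pairing $\pi$, $\delta_\pi(i)=1$ if $i_s=i_t$ for every block $\{s,t\}\in\pi$, and $\delta_\pi(i)=0$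 otherwise. The multi-indices $a_l,a_r$ of length $2k$ are obtained as follows: reading the entries of $a$ row by row, from left to right in each row, replace the entry $a_{ij}$ by $a_{ij}$ consecutive copies of $i$ (to get $a_l$), respectively by $a_{ij}$ consecutive copies of $j$ (to get $a_r$). A path in $D_k$ from $\pi$ to $\sigma$ is a sequence $[\pi=\tau_0\ne\tau_1\ne\cdots\ne\tau_r=\sigma]$ of elements of $D_k$ with $r\ge0$ and consecutive terms distinct (for $r=0$ the path is the single point $\pi=\sigma$). Its signature is $+$ if $r$ is even and $-$ if $r$ is odd. Its total length is $\sum_{i=1}^r d(\tau_{i-1},\tau_i)$. The path is called $a$-admissible if its endpoints satisfy $\delta_\pi(a_l)=1$ and $\delta_\sigma(a_r)=1$. The constant implied by $O(\cdot)$ may depend on $a$ but not on $n$. *)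

theory Defs
  imports
    "HOL-Probability.Probability"
    "HOL-Library.Extended_Nat"
    "HOL-Library.Landau_Symbols"
    "Jordan_Normal_Form.Matrix"
begin

text \<open>
  The size of an orthogonal matrix varies in the asymptotics, so we use matrices whose
  dimensions are terms (type \<^typ>\<open>'a mat\<close>). As usual for this type, all
  indices start at 0: rows and columns are numbered from 0, and the set of \<open>2k\<close>
  points underlying the pairings is \<open>{..<2 * k}\<close>.
\<close>

subsection \<open>Integration over the orthogonal group\<close>

text \<open>
  The constant \<^const>\<open>orthogonal_mat\<close> of \<^theory>\<open>Jordan_Normal_Form.Matrix\<close> only asks for
  orthogonal nonzero columns, so it is not used here.
\<close>

definition orth_group :: "nat \<Rightarrow> real mat set" where
  "orth_group n = {u \<in> carrier_mat n n. transpose_mat u * u = 1\<^sub>m n}"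

text \<open>
  The topology of the orthogonal group is induced by the embedding of the \<open>n \<times> n\<close> matrices into
  the product \<open>\<real>\<^bsup>n \<times> n\<^esup>\<close>, so its Borel sets are the preimages of the Borel sets of this
  finite (hence second countable) product.
\<close>

definition orth_borel :: "nat \<Rightarrow> real mat measure" where
  "orth_borel n = vimage_algebra (orth_group n)
     (\<lambda>u. \<lambda>ij \<in> {..<n} \<times> {..<n}. u $$ ij)
     (\<Pi>\<^sub>M ij \<in> {..<n} \<times> {..<n}. borel)"

text \<open>
  On a compact group, the normalized Haar measure is the only left invariant Borel
  probability measure; regularity is automatic on a compact metrizable space.
\<close>

definition orth_haar :: "nat \<Rightarrow> real mat measure \<Rightarrow> bool" where
  "orth_haar n M \<longleftrightarrow>
     sets M = sets (orth_borel n) \<and> prob_space M \<and>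
     (\<forall>g \<in> orth_group n. \<forall>A \<in> sets M. emeasure M ((\<lambda>u. g * u) ` A) = emeasure M A)"

definition orth_integral :: "real mat measure \<Rightarrow> nat mat \<Rightarrow> real" where
  "orth_integral M a =
     (LINT u|M. (\<Prod>i<dim_row a. \<Prod>j<dim_col a. (u $$ (i, j)) ^ (a $$ (i, j))))"

subsection \<open>The Brauer space\<close>

definition brauer_space :: "nat \<Rightarrow> nat set set set" where
  "brauer_space k = {\<pi>. partition_on {..<2 * k} \<pi> \<and> (\<forall>B \<in> \<pi>. card B = 2)}"

text \<open>The connected components are the classes of the equivalence relation generated by adjacency.\<close>

definition loops :: "nat \<Rightarrow> nat set set \<Rightarrow> nat set set \<Rightarrow> nat" where
  "loops k \<pi> \<sigma> = card ({..<2 * k} // {(s, t). {s, t} \<in> \<pi> \<union> \<sigma>}\<^sup>*)"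

text \<open>The subtraction of natural numbers is not truncated here, see \<open>loops_le\<close> below.\<close>

definition brauer_dist :: "nat \<Rightarrow> nat set set \<Rightarrow> nat set set \<Rightarrow> nat" where
  "brauer_dist k \<pi> \<sigma> = k - loops k \<pi> \<sigma>"

lemma loops_le:
  assumes "\<pi> \<in> brauer_space k"
  shows "loops k \<pi> \<sigma> \<le> k"
proof -
  define V where "V = {..<2 * k}"
  define R where "R = {(s, t). {s, t} \<in> \<pi> \<union> \<sigma>}"
  have part: "partition_on V \<pi>" and two: "\<And>B. B \<in> \<pi> \<Longrightarrow> card B = 2"
    using assms by (auto simp: brauer_space_def V_def)
  have fin: "finite \<pi>"
    using part finite_elements[of V \<pi>] by (simp add: V_def)
  have sym: "sym (R\<^sup>*)"
    by (intro sym_rtrancl) (auto simp: sym_def R_def insert_commute)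
  have "V // R\<^sup>* \<subseteq> (\<lambda>B. R\<^sup>* `` B) ` \<pi>"
  proof
    fix C assume "C \<in> V // R\<^sup>*"
    then obtain x where x: "x \<in> V" and C: "C = R\<^sup>* `` {x}"
      by (auto simp: quotient_def)
    from x part obtain B where B: "B \<in> \<pi>" "x \<in> B"
      by (auto simp: partition_on_def)
    from two[OF B(1)] B(2) obtain y where y: "B = {x, y}"
      by (auto simp: card_2_iff)
    have xy: "(x, y) \<in> R\<^sup>*"
      using B(1) y by (auto simp: R_def)
    have yx: "(y, x) \<in> R\<^sup>*"
      using sym xy by (rule symD)
    have "R\<^sup>* `` B = C"
      using xy yx by (auto simp: C y intro: rtrancl_trans)
    then show "C \<in> (\<lambda>B. R\<^sup>* `` B) ` \<pi>"
      using B(1) by blast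
  qed
  then have "card (V // R\<^sup>*) \<le> card \<pi>"
    by (rule surj_card_le[OF fin])
  moreover have "card V = (\<Sum>B\<in>\<pi>. card B)"
    using part by (intro product_partition) (auto simp: V_def partition_on_def intro: finite_subset)
  moreover have "(\<Sum>B\<in>\<pi>. card B) = 2 * card \<pi>"
    using two by simp
  ultimately show ?thesis
    by (simp add: loops_def V_def R_def)
qed

definition delta :: "nat set set \<Rightarrow> nat list \<Rightarrow> nat" where
  "delta \<pi> i = (if \<forall>B \<in> \<pi>. \<forall>s \<in> B. \<forall>t \<in> B. i ! s = i ! t then 1 else 0)"

definition entry_sum :: "nat mat \<Rightarrow> nat" where
  "entry_sum a = (\<Sum>i<dim_row a. \<Sum>j<dim_col a. a $$ (i, j))"

definition left_index :: "nat mat \<Rightarrow> nat list" where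
  "left_index a =
     concat (map (\<lambda>i. concat (map (\<lambda>j. replicate (a $$ (i, j)) i) [0..<dim_col a])) [0..<dim_row a])"

definition right_index :: "nat mat \<Rightarrow> nat list" where
  "right_index a =
     concat (map (\<lambda>i. concat (map (\<lambda>j. replicate (a $$ (i, j)) j) [0..<dim_col a])) [0..<dim_row a])"

text \<open>
  The minimum is taken over the empty set when some row or column of \<open>a\<close> has an odd sum. Working in
  \<^typ>\<open>enat\<close>, its value is then \<open>\<infinity>\<close>.
\<close>

definition min_dist :: "nat \<Rightarrow> nat mat \<Rightarrow> enat" where
  "min_dist k a =
     Inf {enat (brauer_dist k \<pi> \<sigma>) | \<pi> \<sigma>.
            \<pi> \<in> brauer_space k \<and> \<sigma> \<in> brauer_space k \<and>
            delta \<pi> (left_index a) = 1 \<and> delta \<sigma> (right_index a) = 1}"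

text \<open>The power \<open>x\<^bsup>-e\<^esup>\<close> for \<open>x > 1\<close>, with the limiting value \<open>x\<^bsup>-\<infinity>\<^esup> = 0\<close>.\<close>

definition neg_power :: "real \<Rightarrow> enat \<Rightarrow> real" where
  "neg_power x e = (case e of enat m \<Rightarrow> 1 / x ^ m | \<infinity> \<Rightarrow> 0)"

subsection \<open>Signed count of paths\<close>

text \<open>A path with \<open>r\<close> steps is the list of its \<open>r + 1\<close> points.\<close>

definition brauer_path :: "nat \<Rightarrow> nat set set list \<Rightarrow> bool" where
  "brauer_path k \<tau> \<longleftrightarrow> \<tau> \<noteq> [] \<and> set \<tau> \<subseteq> brauer_space k \<and> distinct_adj \<tau>"

definition path_steps :: "nat set set list \<Rightarrow> nat" where
  "path_steps \<tau> = length \<tau> - 1"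

definition path_length :: "nat \<Rightarrow> nat set set list \<Rightarrow> nat" where
  "path_length k \<tau> = (\<Sum>m<path_steps \<tau>. brauer_dist k (\<tau> ! m) (\<tau> ! Suc m))"

definition admissible :: "nat mat \<Rightarrow> nat set set list \<Rightarrow> bool" where
  "admissible a \<tau> \<longleftrightarrow> delta (hd \<tau>) (left_index a) = 1 \<and> delta (last \<tau>) (right_index a) = 1"

definition min_paths :: "nat \<Rightarrow> nat mat \<Rightarrow> nat set set list set" where
  "min_paths k a =
     {\<tau>. brauer_path k \<tau> \<and> admissible a \<tau> \<and> enat (path_length k \<tau>) = min_dist k a}"

text \<open>
  There are finitely many such paths: distinct pairings have positive distance, so the total
  length bounds the number of steps.
\<close>

definition signed_count :: "nat \<Rightarrow> nat mat \<Rightarrow> int" where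
  "signed_count k a =
     int (card {\<tau> \<in> min_paths k a. even (path_steps \<tau>)}) -
     int (card {\<tau> \<in> min_paths k a. odd (path_steps \<tau>)})"

end

theory Submission
  imports Defs "Jordan_Normal_Form.Determinant"
begin

text \<open>
  Differentiating the invariance under plane rotations expresses a moment with a repeated index \<open>a\<close>
  through moments in which two of the occurrences of \<open>a\<close> are replaced by a fresh index.
  Iterating this, for \<open>n > 2k\<close> the moments are \<open>\<Sum> \<delta>\<^sub>\<pi>(i) \<delta>\<^sub>\<sigma>(j) W(\<pi>, \<sigma>)\<close>, so that no invariant
  theory of \<open>O\<^sub>n\<close> is needed. The orthogonality of the columns shows that \<open>W\<close> is the inverse of the
  Gram matrix \<open>n\<^bsup>loops(\<pi>,\<sigma>)\<^esup>\<close>, which is \<open>n\<^sup>k (1 + \<Lambda>)\<close> with \<open>\<Lambda> = O(1/n)\<close>. The Neumann series of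
  \<open>(1 + \<Lambda>)\<^sup>-\<^sup>1\<close> is a signed sum over paths, cut off with the trivial bound \<open>|W| \<le> 1\<close>; the triangle
  inequality for \<open>d\<close> shows that no path is shorter than \<open>e(a)\<close>.
\<close>

subsection \<open>Moments of the Haar measure\<close>

text \<open>The Haar measure is given by left invariance alone, which acts on the row indices only.
  Symmetry of the moments in rows and columns carries each result over to the columns. What remains
  at the end are indices whose equal entries are exactly the blocks of a pairing. The moment at such
  an index depends only on the pairing, so W(\<pi>, \<sigma>) is itself the integral of a monomial
  in entries of absolute value at most 1. This is the source of the trivial bound. That bound is too
  large by about n^k, but every step of a path gains a factor 1/n, since distinct pairings are at
  distance at least 1. Hence k + e(a) + 1 steps bring the remainder below the leading term, and the
  Neumann series is only needed as a finite identity with remainder. If e(a) is infinite, the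
  integral has to vanish exactly for all n \<ge> max(p, q), including small n; this case rests on
  parity instead.\<close>

lemma orth_group_iff:
  "u \<in> orth_group n \<longleftrightarrow> u \<in> carrier_mat n n \<and>
     (\<forall>r<n. \<forall>c<n. (\<Sum>l<n. u $$ (l, r) * u $$ (l, c)) = of_bool (r = c))"
proof (cases "u \<in> carrier_mat n n")
  case True
  then have "dim_row (transpose_mat u * u) = n" "dim_col (transpose_mat u * u) = n"
    by auto
  then have "transpose_mat u * u = 1\<^sub>m n \<longleftrightarrow>
      (\<forall>r<n. \<forall>c<n. (transpose_mat u * u) $$ (r, c) = 1\<^sub>m n $$ (r, c))"
    by (subst mat_eq_iff) simp
  moreover have "(transpose_mat u * u) $$ (r, c) = (\<Sum>l<n. u $$ (l, r) * u $$ (l, c))"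
    if "r < n" "c < n" for r c
    using True that by (auto simp: scalar_prod_def lessThan_atLeast0 intro!: sum.cong)
  ultimately show ?thesis
    using True by (auto simp: orth_group_def)
qed (auto simp: orth_group_def)

lemma orth_group_right_inverse:
  assumes "u \<in> orth_group n"
  shows "u * transpose_mat u = 1\<^sub>m n"
  using assms mat_mult_left_right_inverse[of "transpose_mat u" n u]
  by (auto simp: orth_group_def)

lemma transpose_orth_group:
  assumes "u \<in> orth_group n"
  shows "transpose_mat u \<in> orth_group n"
  using assms orth_group_right_inverse[OF assms] by (auto simp: orth_group_def)

lemma mult_orth_group:
  assumes "g \<in> orth_group n" "u \<in> orth_group n"
  shows "g * u \<in> orth_group n"
proof -
  have g: "g \<in> carrier_mat n n" "transpose_mat g * g = 1\<^sub>m n"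
    and u: "u \<in> carrier_mat n n" "transpose_mat u * u = 1\<^sub>m n"
    using assms by (auto simp: orth_group_def)
  have "transpose_mat (g * u) * (g * u) = transpose_mat u * (transpose_mat g * g) * u"
    using g(1) u(1) by (simp add: transpose_mult[OF g(1) u(1)] assoc_mult_mat[of _ n n _ n _ n])
  then show ?thesis
    using g u by (simp add: orth_group_def)
qed

lemma abs_entry_le_1:
  assumes "u \<in> orth_group n" "r < n" "c < n"
  shows "\<bar>u $$ (r, c)\<bar> \<le> 1"
proof -
  have "(u $$ (r, c))\<^sup>2 \<le> (\<Sum>l<n. (u $$ (l, c))\<^sup>2)"
    using assms(2) by (intro member_le_sum) auto
  also have "\<dots> = 1"
    using assms by (simp add: orth_group_iff power2_eq_square)
  finally show ?thesis
    by (simp add: abs_square_le_1)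
qed

lemma mult_entry:
  assumes "g \<in> orth_group n" "u \<in> orth_group n" "r < n" "c < n"
  shows "(g * u) $$ (r, c) = (\<Sum>l<n. g $$ (r, l) * u $$ (l, c))"
  using assms by (auto simp: orth_group_def scalar_prod_def lessThan_atLeast0 intro!: sum.cong)

text \<open>The indices are functions, of which only the values below \<open>m\<close> count, so
  that changing one entry is a function update.\<close>

definition moment :: "real mat measure \<Rightarrow> nat \<Rightarrow> (nat \<Rightarrow> nat) \<Rightarrow> (nat \<Rightarrow> nat) \<Rightarrow> real" where
  "moment M m i j = (LINT u|M. (\<Prod>s<m. u $$ (i s, j s)))"

lemma moment_cong:
  assumes "\<And>s. s < m \<Longrightarrow> i s = i' s" "\<And>s. s < m \<Longrightarrow> j s = j' s"
  shows "moment M m i j = moment M m i' j'"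
  using assms by (simp add: moment_def)

section \<open>Invariance of the Haar measure, in terms of moments\<close>

locale orth_haar_measure =
  fixes n :: nat and M :: "real mat measure"
  assumes haar: "orth_haar n M"
begin

sublocale prob_space M
  using haar by (simp add: orth_haar_def)

lemma sets_eq: "sets M = sets (orth_borel n)"
  using haar by (simp add: orth_haar_def)

lemma space_eq: "space M = orth_group n"
  using sets_eq_imp_space_eq[OF sets_eq] by (simp add: orth_borel_def)

lemma measurable_entries:
  "(\<lambda>u. \<lambda>ij \<in> {..<n} \<times> {..<n}. u $$ ij) \<in> measurable M (\<Pi>\<^sub>M ij \<in> {..<n} \<times> {..<n}. borel)"
  unfolding measurable_cong_sets[OF sets_eq refl] orth_borel_def
  by (rule measurable_vimage_algebra1) (auto simp: space_PiM)

lemma measurable_entry [measurable]: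
  assumes "r < n" "c < n"
  shows "(\<lambda>u. u $$ (r, c)) \<in> borel_measurable M"
proof -
  have "(\<lambda>u. (\<lambda>ij \<in> {..<n} \<times> {..<n}. u $$ ij) (r, c)) \<in> borel_measurable M"
    using assms by (intro measurable_compose[OF measurable_entries] measurable_component_singleton) auto
  then show ?thesis
    using assms by simp
qed

lemma measurable_left_mult:
  assumes g: "g \<in> orth_group n"
  shows "(*) g \<in> measurable M M"
proof -
  have "(\<lambda>u. \<lambda>ij \<in> {..<n} \<times> {..<n}. (g * u) $$ ij)
      \<in> measurable M (\<Pi>\<^sub>M ij \<in> {..<n} \<times> {..<n}. borel)"
  proof (rule measurable_restrict)
    fix ij :: "nat \<times> nat" assume "ij \<in> {..<n} \<times> {..<n}"
    then obtain r c where rc: "ij = (r, c)" "r < n" "c < n"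
      by auto
    have "(\<lambda>u. \<Sum>l<n. g $$ (r, l) * u $$ (l, c)) \<in> borel_measurable M"
      using rc by (intro borel_measurable_sum borel_measurable_times) auto
    then show "(\<lambda>u. (g * u) $$ ij) \<in> borel_measurable M"
      using rc g by (subst measurable_cong[of _ _ "\<lambda>u. \<Sum>l<n. g $$ (r, l) * u $$ (l, c)"])
        (auto simp: space_eq mult_entry)
  qed
  moreover have "(*) g \<in> space M \<rightarrow> orth_group n"
    using g by (auto simp: space_eq mult_orth_group)
  ultimately have "(*) g \<in> measurable M (orth_borel n)"
    unfolding orth_borel_def by (intro measurable_vimage_algebra2)
  then show ?thesis
    unfolding measurable_cong_sets[OF refl sets_eq] .
qed

text \<open>Invariance is assumed for images of sets, whereas the push-forward measures preimages;
  the preimage under multiplication by \<open>g\<close> is the image under multiplication by its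
  transpose.\<close>

lemma distr_left_mult:
  assumes g: "g \<in> orth_group n"
  shows "distr M M ((*) g) = M"
proof (rule measure_eqI)
  fix A assume "A \<in> sets (distr M M ((*) g))"
  then have A: "A \<in> sets M" by simp
  let ?h = "transpose_mat g"
  have h: "?h \<in> orth_group n"
    using g by (rule transpose_orth_group)
  have carr: "g \<in> carrier_mat n n" "?h \<in> carrier_mat n n"
    using g h by (auto simp: orth_group_def)
  have hg: "?h * (g * u) = u" "g * (?h * u) = u" if "u \<in> orth_group n" for u
  proof -
    have u: "u \<in> carrier_mat n n"
      using that by (simp add: orth_group_def)
    show "?h * (g * u) = u"
      using g u by (simp add: assoc_mult_mat[OF carr(2,1) u, symmetric] orth_group_def)
    show "g * (?h * u) = u"
      using u by (simp add: assoc_mult_mat[OF carr u, symmetric] orth_group_right_inverse[OF g])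
  qed
  have A': "A \<subseteq> orth_group n"
    using sets.sets_into_space[OF A] by (simp add: space_eq)
  have "(*) g -` A \<inter> space M = (\<lambda>u. ?h * u) ` A"
  proof (intro equalityI subsetI)
    fix u assume "u \<in> (*) g -` A \<inter> space M"
    then show "u \<in> (\<lambda>u. ?h * u) ` A"
      using hg by (intro image_eqI[of _ _ "g * u"]) (auto simp: space_eq)
  next
    fix u assume "u \<in> (\<lambda>u. ?h * u) ` A"
    then show "u \<in> (*) g -` A \<inter> space M"
      using hg A' h by (auto simp: space_eq intro: mult_orth_group)
  qed
  then have "emeasure (distr M M ((*) g)) A = emeasure M ((\<lambda>u. ?h * u) ` A)"
    using A by (simp add: emeasure_distr measurable_left_mult[OF g])
  also have "\<dots> = emeasure M A"
    using haar h A by (auto simp: orth_haar_def)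
  finally show "emeasure (distr M M ((*) g)) A = emeasure M A" .
qed simp

lemma measurable_monomial [measurable]:
  assumes "i \<in> {..<m} \<rightarrow> {..<n}" "j \<in> {..<m} \<rightarrow> {..<n}"
  shows "(\<lambda>u. \<Prod>s<m. u $$ (i s, j s)) \<in> borel_measurable M"
  using assms by (intro borel_measurable_prod measurable_entry) auto

lemma abs_monomial_le_1:
  assumes "i \<in> {..<m} \<rightarrow> {..<n}" "j \<in> {..<m} \<rightarrow> {..<n}" "u \<in> orth_group n"
  shows "\<bar>\<Prod>s<m. u $$ (i s, j s)\<bar> \<le> 1"
  using assms abs_entry_le_1[OF assms(3)] by (auto simp: abs_prod intro!: prod_le_1)

lemma integrable_monomial:
  assumes "i \<in> {..<m} \<rightarrow> {..<n}" "j \<in> {..<m} \<rightarrow> {..<n}"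
  shows "integrable M (\<lambda>u. \<Prod>s<m. u $$ (i s, j s))"
  using assms abs_monomial_le_1[OF assms]
  by (intro integrable_const_bound[of _ 1] measurable_monomial) (auto simp: space_eq)

lemma abs_moment_le_1:
  assumes "i \<in> {..<m} \<rightarrow> {..<n}" "j \<in> {..<m} \<rightarrow> {..<n}"
  shows "\<bar>moment M m i j\<bar> \<le> 1"
proof -
  have "norm (moment M m i j) \<le> (LINT u|M. norm (\<Prod>s<m. u $$ (i s, j s)))"
    unfolding moment_def by (rule integral_norm_bound)
  also have "\<dots> \<le> (LINT u|M. 1)"
    using abs_monomial_le_1[OF assms] integrable_monomial[OF assms]
    by (intro integral_mono) (auto simp: space_eq)
  finally show ?thesis
    by (simp add: prob_space)
qed

text \<open>Substitute \<open>g * u\<close> for \<open>u\<close> and expand the product of the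
  \<open>m\<close> row sums over all choices \<open>l\<close> of summation indices. All later uses
  of invariance go through this identity.\<close>

lemma moment_left_mult:
  assumes g: "g \<in> orth_group n"
    and i: "i \<in> {..<m} \<rightarrow> {..<n}" and j: "j \<in> {..<m} \<rightarrow> {..<n}"
  shows "moment M m i j =
    (\<Sum>l\<in>{..<m} \<rightarrow>\<^sub>E {..<n}. (\<Prod>s<m. g $$ (i s, l s)) * moment M m l j)"
proof -
  have "moment M m i j = (LINT u|distr M M ((*) g). (\<Prod>s<m. u $$ (i s, j s)))"
    by (simp add: moment_def distr_left_mult[OF g])
  also have "\<dots> = (LINT u|M. (\<Prod>s<m. (g * u) $$ (i s, j s)))"
    using i j by (intro integral_distr measurable_left_mult[OF g] measurable_monomial)
  also have "\<dots> = (LINT u|M. (\<Sum>l\<in>{..<m} \<rightarrow>\<^sub>E {..<n}.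
      (\<Prod>s<m. g $$ (i s, l s)) * (\<Prod>s<m. u $$ (l s, j s))))"
  proof (rule Bochner_Integration.integral_cong[OF refl])
    fix u assume "u \<in> space M"
    then have "(\<Prod>s<m. (g * u) $$ (i s, j s)) =
        (\<Prod>s<m. \<Sum>l<n. g $$ (i s, l) * u $$ (l, j s))"
      using i j g by (intro prod.cong mult_entry) (auto simp: space_eq)
    then show "(\<Prod>s<m. (g * u) $$ (i s, j s)) = (\<Sum>l\<in>{..<m} \<rightarrow>\<^sub>E {..<n}.
        (\<Prod>s<m. g $$ (i s, l s)) * (\<Prod>s<m. u $$ (l s, j s)))"
      by (simp add: prod_sum_PiE prod.distrib)
  qed
  also have "\<dots> = (\<Sum>l\<in>{..<m} \<rightarrow>\<^sub>E {..<n}. (\<Prod>s<m. g $$ (i s, l s)) * moment M m l j)"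
    using j unfolding moment_def
    by (subst Bochner_Integration.integral_sum)
       (auto intro!: sum.cong integrable_mult_right integrable_monomial)
  finally show ?thesis .
qed

text \<open>
  Averaging the left invariance under \<open>u\<^sup>T\<close> over \<open>u\<close> gives an expression that is symmetric
  in \<open>i\<close> and \<open>j\<close>; this replaces the right invariance and the inversion invariance of the Haar
  measure.
\<close>

lemma moment_commute:
  assumes i: "i \<in> {..<m} \<rightarrow> {..<n}" and j: "j \<in> {..<m} \<rightarrow> {..<n}"
  shows "moment M m i j = moment M m j i"
proof -
  have *: "moment M m i j =
      (\<Sum>l\<in>{..<m} \<rightarrow>\<^sub>E {..<n}. moment M m l i * moment M m l j)"
    if i: "i \<in> {..<m} \<rightarrow> {..<n}" and j: "j \<in> {..<m} \<rightarrow> {..<n}" for i j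
  proof -
    have "moment M m i j = (LINT u|M. moment M m i j)"
      by (simp add: prob_space)
    also have "\<dots> = (LINT u|M. (\<Sum>l\<in>{..<m} \<rightarrow>\<^sub>E {..<n}.
        (\<Prod>s<m. u $$ (l s, i s)) * moment M m l j))"
    proof (rule Bochner_Integration.integral_cong[OF refl])
      fix u assume "u \<in> space M"
      then have u: "u \<in> orth_group n" "u \<in> carrier_mat n n"
        by (auto simp: space_eq orth_group_def)
      have "transpose_mat u $$ (i s, l s) = u $$ (l s, i s)"
        if "l \<in> {..<m} \<rightarrow>\<^sub>E {..<n}" "s < m" for l s
        using that u i by (intro index_transpose_mat) (auto simp: PiE_def Pi_def)
      then show "moment M m i j = (\<Sum>l\<in>{..<m} \<rightarrow>\<^sub>E {..<n}.
          (\<Prod>s<m. u $$ (l s, i s)) * moment M m l j)"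
        by (subst moment_left_mult[OF transpose_orth_group[OF u(1)] i j])
           (auto intro!: sum.cong prod.cong)
    qed
    also have "\<dots> = (\<Sum>l\<in>{..<m} \<rightarrow>\<^sub>E {..<n}. moment M m l i * moment M m l j)"
      using i unfolding moment_def
      by (subst Bochner_Integration.integral_sum)
         (auto intro!: sum.cong integrable_mult_left integrable_monomial)
    finally show ?thesis .
  qed
  show ?thesis
    by (simp add: *[OF i j] *[OF j i] mult.commute)
qed

section \<open>Signs, permutations and plane rotations\<close>

text \<open>The matrix with entry \<open>\<epsilon> r\<close> at \<open>(r, p r)\<close> and zeros
  elsewhere is orthogonal, and only one choice of \<open>l\<close> survives in
  \<open>moment_left_mult\<close>. Trivial \<open>p\<close> gives the parity condition, trivial
  signs allow the values of an index to be renamed.\<close>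

lemma moment_signed_permutation:
  assumes p: "p permutes {..<n}" and eps: "\<And>r. r < n \<Longrightarrow> \<epsilon> r * \<epsilon> r = 1"
    and i: "i \<in> {..<m} \<rightarrow> {..<n}" and j: "j \<in> {..<m} \<rightarrow> {..<n}"
  shows "moment M m i j = (\<Prod>s<m. \<epsilon> (i s)) * moment M m (\<lambda>s. p (i s)) j"
proof -
  define g where "g = mat n n (\<lambda>(r, c). if c = p r then \<epsilon> r else 0)"
  have p_less: "p r < n" if "r < n" for r
    using permutes_in_image[OF p, of r] that by simp
  have "(\<Sum>l<n. g $$ (l, r) * g $$ (l, c)) = of_bool (r = c)" if "r < n" "c < n" for r c
  proof -
    have "(\<Sum>l<n. g $$ (l, r) * g $$ (l, c)) = (\<Sum>l<n. of_bool (p l = r) * of_bool (p l = c))"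
      using that eps by (intro sum.cong) (auto simp: g_def)
    also have "\<dots> = (\<Sum>l<n. of_bool (l = r) * of_bool (l = c))"
      using sum.permute[OF p, of "\<lambda>l. of_bool (l = r) * of_bool (l = c)"]
      unfolding o_def by (rule sym)
    also have "\<dots> = (\<Sum>l<n. if l = r then of_bool (r = c) else 0)"
      by (intro sum.cong) auto
    also have "\<dots> = of_bool (r = c)"
      using that by simp
    finally show ?thesis .
  qed
  then have g: "g \<in> orth_group n"
    by (simp add: orth_group_iff) (simp add: g_def)
  define l0 where "l0 = (\<lambda>s\<in>{..<m}. p (i s))"
  have l0: "l0 \<in> {..<m} \<rightarrow>\<^sub>E {..<n}"
    using i p_less by (auto simp: l0_def)
  have "(\<Prod>s<m. g $$ (i s, l s)) * moment M m l j =
      (if l = l0 then (\<Prod>s<m. \<epsilon> (i s)) * moment M m l0 j else 0)"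
    if l: "l \<in> {..<m} \<rightarrow>\<^sub>E {..<n}" for l
  proof (cases "l = l0")
    case True
    have "g $$ (i s, l s) = \<epsilon> (i s)" if "s < m" for s
      using i that p_less by (auto simp: True g_def l0_def Pi_def)
    then show ?thesis
      using True by simp
  next
    case False
    then obtain s where s: "s < m" "l s \<noteq> l0 s"
      using l l0 by (metis PiE_ext lessThan_iff)
    have "i s < n" "l s < n"
      using s(1) i l by (auto simp: PiE_def Pi_def)
    then have "g $$ (i s, l s) = 0"
      using s by (simp add: g_def l0_def)
    then have "(\<Prod>s<m. g $$ (i s, l s)) = 0"
      using s(1) by (intro prod_zero) auto
    then show ?thesis
      using False by simp
  qed
  then have "moment M m i j = (\<Sum>l\<in>{..<m} \<rightarrow>\<^sub>E {..<n}.
      if l = l0 then (\<Prod>s<m. \<epsilon> (i s)) * moment M m l0 j else 0)"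
    by (simp add: moment_left_mult[OF g i j])
  also have "\<dots> = (\<Prod>s<m. \<epsilon> (i s)) * moment M m l0 j"
    using l0 by (simp add: finite_PiE)
  also have "moment M m l0 j = moment M m (\<lambda>s. p (i s)) j"
    by (rule moment_cong) (auto simp: l0_def)
  finally show ?thesis .
qed

text \<open>Reversing the sign of the coordinate \<open>a\<close> changes the sign of the
  moment.\<close>

lemma moment_odd_eq_0:
  assumes i: "i \<in> {..<m} \<rightarrow> {..<n}" and j: "j \<in> {..<m} \<rightarrow> {..<n}"
    and odd: "odd (card {s \<in> {..<m}. i s = a})"
  shows "moment M m i j = 0"
proof -
  have "moment M m i j =
      (\<Prod>s<m. (if i s = a then -1 else 1)) * moment M m (\<lambda>s. id (i s)) j"
    by (rule moment_signed_permutation[OF permutes_id _ i j]) simp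
  also have "(\<Prod>s<m. (if i s = a then -1 else 1 :: real)) = (\<Prod>s\<in>{s \<in> {..<m}. i s = a}. -1)"
    by (rule prod.inter_filter[symmetric]) simp
  also have "\<dots> = -1"
    using odd by simp
  finally show ?thesis
    by simp
qed

text \<open>Indices with the same coincidences differ by a bijection \<open>f\<close> between their
  images. The complements of the images in \<open>{..<n}\<close> have equal size, so
  \<open>f\<close> extends to a permutation of the coordinates.\<close>

lemma moment_kernel_cong:
  assumes i: "i \<in> {..<m} \<rightarrow> {..<n}" and i': "i' \<in> {..<m} \<rightarrow> {..<n}"
    and j: "j \<in> {..<m} \<rightarrow> {..<n}"
    and ker: "\<And>s t. s < m \<Longrightarrow> t < m \<Longrightarrow> i s = i t \<longleftrightarrow> i' s = i' t"
  shows "moment M m i j = moment M m i' j"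
proof -
  define A where "A = i ` {..<m}"
  define A' where "A' = i' ` {..<m}"
  define f where "f = (\<lambda>a. i' (SOME s. s < m \<and> i s = a))"
  have f: "f (i s) = i' s" if "s < m" for s
  proof -
    have "\<exists>t. t < m \<and> i t = i s"
      using that by auto
    then have "(SOME t. t < m \<and> i t = i s) < m \<and> i (SOME t. t < m \<and> i t = i s) = i s"
      by (rule someI_ex)
    then show ?thesis
      using ker that by (auto simp: f_def)
  qed
  have bij_f: "bij_betw f A A'"
  proof (rule bij_betw_imageI)
    show "inj_on f A"
      by (auto simp: inj_on_def A_def f ker)
    show "f ` A = A'"
      using f by (force simp: A_def A'_def image_iff)
  qed
  have sub: "A \<subseteq> {..<n}" "A' \<subseteq> {..<n}"
    using i i' by (auto simp: A_def A'_def)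
  then have "card ({..<n} - A) = card ({..<n} - A')"
    using bij_betw_same_card[OF bij_f] by (simp add: card_Diff_subset finite_subset)
  then obtain h where bij_h: "bij_betw h ({..<n} - A) ({..<n} - A')"
    using finite_same_card_bij by (metis finite_Diff finite_lessThan)
  define p where "p = (\<lambda>x. if x \<in> A then f x else if x < n then h x else x)"
  have "bij_betw p (A \<union> ({..<n} - A)) (A' \<union> ({..<n} - A'))"
  proof (rule bij_betw_combine)
    show "bij_betw p A A'"
      using bij_f by (subst bij_betw_cong[of _ _ f]) (auto simp: p_def)
    show "bij_betw p ({..<n} - A) ({..<n} - A')"
      using bij_h by (subst bij_betw_cong[of _ _ h]) (auto simp: p_def)
  qed auto
  then have p: "p permutes {..<n}"
    using sub by (intro bij_imp_permutes) (auto simp: p_def Un_absorb1)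
  have "moment M m i j = (\<Prod>s<m. 1) * moment M m (\<lambda>s. p (i s)) j"
    by (rule moment_signed_permutation[OF p _ i j]) simp
  also have "moment M m (\<lambda>s. p (i s)) j = moment M m i' j"
    by (rule moment_cong) (auto simp: p_def A_def f)
  finally show ?thesis
    by simp
qed

text \<open>The derivative at \<open>\<theta> = 0\<close> of the invariance under rotations in the plane of \<open>a\<close> and \<open>b\<close>.\<close>

lemma moment_rotation:
  assumes i: "i \<in> {..<m} \<rightarrow> {..<n}" and j: "j \<in> {..<m} \<rightarrow> {..<n}"
    and ab: "a < n" "b < n" "a \<noteq> b"
  shows "(\<Sum>s\<in>{s \<in> {..<m}. i s = a}. moment M m (i(s := b)) j) =
         (\<Sum>s\<in>{s \<in> {..<m}. i s = b}. moment M m (i(s := a)) j)"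
proof -
  define R :: "real \<Rightarrow> nat \<Rightarrow> nat \<Rightarrow> real" where "R = (\<lambda>\<theta> r c.
    if r = a then (if c = a then cos \<theta> else if c = b then - sin \<theta> else 0)
    else if r = b then (if c = a then sin \<theta> else if c = b then cos \<theta> else 0)
    else of_bool (r = c))"
  \<comment> \<open>The infinitesimal rotation, that is, the derivative of \<open>R\<close> at
    0.\<close>
  define X :: "nat \<Rightarrow> nat \<Rightarrow> real" where "X = (\<lambda>r c.
    if r = a then (if c = b then -1 else 0) else if r = b then (if c = a then 1 else 0) else 0)"
  have R0: "R 0 r c = of_bool (r = c)" for r c
    by (auto simp: R_def)
  have dR: "((\<lambda>\<theta>. R \<theta> r c) has_field_derivative X r c) (at 0)" for r c
    by (auto simp: R_def X_def ab intro!: derivative_eq_intros)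
  have "mat n n (\<lambda>(r, c). R \<theta> r c) \<in> orth_group n" for \<theta>
  proof -
    have "(\<Sum>l<n. R \<theta> l r * R \<theta> l c) = of_bool (r = c)" if "r < n" "c < n" for r c
    proof -
      have "(\<Sum>l<n. R \<theta> l r * R \<theta> l c) =
          (\<Sum>l\<in>insert a (insert b ({..<n} - {a, b})). R \<theta> l r * R \<theta> l c)"
        using ab by (intro sum.cong) auto
      also have "\<dots> = R \<theta> a r * R \<theta> a c + (R \<theta> b r * R \<theta> b c +
          (\<Sum>l\<in>{..<n} - {a, b}. R \<theta> l r * R \<theta> l c))"
        using ab by simp
      also have "(\<Sum>l\<in>{..<n} - {a, b}. R \<theta> l r * R \<theta> l c) =
          (\<Sum>l\<in>{..<n} - {a, b}. if l = r then of_bool (r = c) else 0)"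
        by (intro sum.cong) (auto simp: R_def)
      also have "\<dots> = (if r \<in> {..<n} - {a, b} then of_bool (r = c) else 0)"
        by (rule sum.delta) simp
      finally show ?thesis
        using that ab by (auto simp: R_def power2_eq_square[symmetric])
    qed
    then show ?thesis
      by (simp add: orth_group_iff)
  qed
  note rot = this
  define N where "N = ({..<m} \<rightarrow>\<^sub>E {..<n})"
  have fin: "finite N"
    by (simp add: N_def finite_PiE)
  have "moment M m i j = (\<Sum>l\<in>N. (\<Prod>s<m. R \<theta> (i s) (l s)) * moment M m l j)" for \<theta>
    unfolding moment_left_mult[OF rot[of \<theta>] i j] N_def using i
    by (intro sum.cong arg_cong2[of _ _ _ _ "(*)"] prod.cong refl) (auto simp: PiE_def Pi_def)
  \<comment> \<open>The left-hand side of the expansion does not depend on the angle, so its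
    derivative is 0.\<close>
  then have "(\<lambda>\<theta>. \<Sum>l\<in>N. (\<Prod>s<m. R \<theta> (i s) (l s)) * moment M m l j) = (\<lambda>\<theta>. moment M m i j)"
    by (intro ext) (rule sym)
  then have "((\<lambda>\<theta>. \<Sum>l\<in>N. (\<Prod>s<m. R \<theta> (i s) (l s)) * moment M m l j)
      has_field_derivative 0) (at 0)"
    by simp
  moreover have "((\<lambda>\<theta>. \<Sum>l\<in>N. (\<Prod>s<m. R \<theta> (i s) (l s)) * moment M m l j)
      has_field_derivative (\<Sum>l\<in>N. (\<Sum>s<m. X (i s) (l s) *
        (\<Prod>t\<in>{..<m} - {s}. R 0 (i t) (l t))) * moment M m l j)) (at 0)"
    by (intro DERIV_sum DERIV_cmult_right has_field_derivative_prod dR)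
  ultimately have "0 = (\<Sum>l\<in>N. (\<Sum>s<m. X (i s) (l s) *
        (\<Prod>t\<in>{..<m} - {s}. R 0 (i t) (l t))) * moment M m l j)"
    by (rule DERIV_unique)
  also have "\<dots> = (\<Sum>l\<in>N. \<Sum>s<m. X (i s) (l s) *
        (\<Prod>t\<in>{..<m} - {s}. of_bool (i t = l t)) * moment M m l j)"
    by (simp add: sum_distrib_right R0)
  also have "\<dots> = (\<Sum>s<m. \<Sum>l\<in>N. X (i s) (l s) *
        (\<Prod>t\<in>{..<m} - {s}. of_bool (i t = l t)) * moment M m l j)"
    by (rule sum.swap)
  also have "\<dots> = (\<Sum>s<m. (if i s = b then moment M m (i(s := a)) j else 0) -
      (if i s = a then moment M m (i(s := b)) j else 0))"
  proof (rule sum.cong[OF refl])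
    fix s assume "s \<in> {..<m}"
    then have s: "s < m" by simp
    \<comment> \<open>Only the factor at \<open>s\<close> is differentiated. The other factors,
      taken at angle 0, force \<open>l t = i t\<close>, and the row \<open>i s\<close> of
      \<open>X\<close> has at most one nonzero entry, in column \<open>v\<close>. So only the index
      \<open>i(s := v)\<close> contributes.\<close>
    have *: "(\<Sum>l\<in>N. X (i s) (l s) * (\<Prod>t\<in>{..<m} - {s}. of_bool (i t = l t)) * moment M m l j)
        = x * moment M m (i(s := v)) j"
      if v: "v < n" and X: "\<And>c. X (i s) c = (if c = v then x else 0)" for v x
    proof -
      define l0 where "l0 = restrict (i(s := v)) {..<m}"
      have l0: "l0 \<in> N"
        using i v by (auto simp: l0_def N_def)
      have "X (i s) (l s) * (\<Prod>t\<in>{..<m} - {s}. of_bool (i t = l t)) * moment M m l j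
          = (if l = l0 then x * moment M m l0 j else 0)" if l: "l \<in> N" for l
      proof (cases "l = l0")
        case True
        have "X (i s) (l s) = x"
          unfolding X using s by (simp add: True l0_def)
        moreover have "(\<Prod>t\<in>{..<m} - {s}. of_bool (i t = l t) :: real) = 1"
          by (rule prod.neutral) (auto simp: True l0_def)
        ultimately show ?thesis
          by (simp only: True mult_1_right) simp
      next
        case False
        then obtain t where t: "t < m" "l t \<noteq> l0 t"
          using l l0 unfolding N_def by (metis PiE_ext lessThan_iff)
        have "X (i s) (l s) * (\<Prod>t\<in>{..<m} - {s}. of_bool (i t = l t) :: real) = 0"
        proof (cases "t = s")
          case True
          then have "X (i s) (l s) = 0"
            unfolding X using t by (simp add: l0_def)
          then show ?thesis
            by simp
        next
          case False
          then have "(\<Prod>t\<in>{..<m} - {s}. of_bool (i t = l t) :: real) = 0"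
            using t by (intro prod_zero) (auto simp: l0_def intro!: bexI[of _ t])
          then show ?thesis
            by simp
        qed
        then show ?thesis
          using False by simp
      qed
      then have "(\<Sum>l\<in>N. X (i s) (l s) * (\<Prod>t\<in>{..<m} - {s}. of_bool (i t = l t)) * moment M m l j)
          = (\<Sum>l\<in>N. if l = l0 then x * moment M m l0 j else 0)"
        by (intro sum.cong) auto
      also have "\<dots> = x * moment M m l0 j"
        using l0 fin by simp
      also have "moment M m l0 j = moment M m (i(s := v)) j"
        by (rule moment_cong) (auto simp: l0_def)
      finally show ?thesis .
    qed
    show "(\<Sum>l\<in>N. X (i s) (l s) * (\<Prod>t\<in>{..<m} - {s}. of_bool (i t = l t)) * moment M m l j)
        = (if i s = b then moment M m (i(s := a)) j else 0) -
          (if i s = a then moment M m (i(s := b)) j else 0)"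
      \<comment> \<open>The three cases are \<open>i s = a\<close>, \<open>i s = b\<close>, and a
        zero row of \<open>X\<close>, where the column is arbitrary.\<close>
      using *[of b "-1"] *[of a 1] *[of a 0] ab by (auto simp: X_def)
  qed
  finally show ?thesis
    unfolding sum.inter_filter[OF finite_lessThan] sum_subtractf by simp
qed

text \<open>Apply \<open>moment_rotation\<close> to \<open>i(x := b)\<close>. The fresh value
  \<open>b\<close> occurs there only at \<open>x\<close>, so one side is the single moment at
  \<open>i\<close>; on the other side each remaining occurrence \<open>y\<close> of
  \<open>i x\<close> becomes \<open>b\<close>. If there is none, the moment is 0.\<close>

lemma moment_split:
  assumes i: "i \<in> {..<m} \<rightarrow> {..<n}" and j: "j \<in> {..<m} \<rightarrow> {..<n}"
    and x: "x < m" and b: "b < n" "b \<notin> i ` {..<m}"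
  shows "moment M m i j =
    (\<Sum>y\<in>{y \<in> {..<m} - {x}. i y = i x}. moment M m (i(x := b, y := b)) j)"
proof -
  let ?i = "i(x := b)" and ?a = "i x"
  have eq: "{s \<in> {..<m}. ?i s = ?a} = {y \<in> {..<m} - {x}. i y = i x}"
    "{s \<in> {..<m}. ?i s = b} = {x}"
    using x b by auto
  have "?i \<in> {..<m} \<rightarrow> {..<n}" "?a < n" "?a \<noteq> b"
    using i x b by auto
  from moment_rotation[OF this(1) j this(2) b(1) this(3)] show ?thesis
    unfolding eq by simp
qed

end

subsection \<open>Pairings\<close>

text \<open>The ground set is arbitrary so that inductions can remove the two points of a
  block.\<close>

definition pairings :: "'a set \<Rightarrow> 'a set set set" where
  "pairings U = {\<pi>. partition_on U \<pi> \<and> (\<forall>B\<in>\<pi>. card B = 2)}"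

lemma pairings_empty [simp]: "pairings {} = {{}}"
  by (auto simp: pairings_def partition_on_def)

lemma finite_pairings: "finite U \<Longrightarrow> finite (pairings U)"
  by (rule finite_subset[of _ "Pow (Pow U)"]) (auto simp: pairings_def partition_on_def)

lemma pairings_block:
  assumes "\<pi> \<in> pairings U" "B \<in> \<pi>"
  obtains s t where "B = {s, t}" "s \<noteq> t" "s \<in> U" "t \<in> U"
proof -
  have "card B = 2" "B \<subseteq> U"
    using assms by (auto simp: pairings_def partition_on_def)
  then show ?thesis
    using that by (auto simp: card_2_iff)
qed

lemma pairings_unique:
  assumes "\<pi> \<in> pairings U" "B \<in> \<pi>" "C \<in> \<pi>" "s \<in> B" "s \<in> C"
  shows "B = C"
proof (rule ccontr)
  assume "B \<noteq> C"
  moreover have "disjoint \<pi>"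
    using assms(1) by (simp add: pairings_def partition_on_def)
  ultimately have "B \<inter> C = {}"
    using assms(2,3) by (intro disjointD)
  then show False
    using assms(4,5) by blast
qed

lemma pairings_partner:
  assumes "\<pi> \<in> pairings U" "s \<in> U"
  obtains t where "t \<in> U" "t \<noteq> s" "{s, t} \<in> \<pi>"
proof -
  obtain B where B: "B \<in> \<pi>" "s \<in> B"
    using assms by (auto simp: pairings_def partition_on_def)
  from pairings_block[OF assms(1) B(1)] obtain x y
    where "B = {x, y}" "x \<noteq> y" "x \<in> U" "y \<in> U" .
  with B that show ?thesis
    by (metis insert_commute insert_iff singletonD)
qed

lemma pairings_subset_imp_eq:
  assumes "\<rho> \<in> pairings U" "\<tau> \<in> pairings U" "\<rho> \<subseteq> \<tau>"
  shows "\<rho> = \<tau>"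
proof
  show "\<tau> \<subseteq> \<rho>"
  proof
    fix B assume B: "B \<in> \<tau>"
    from pairings_block[OF assms(2) B] obtain s where s: "s \<in> B" "s \<in> U"
      by blast
    from pairings_partner[OF assms(1) s(2)] obtain t where "{s, t} \<in> \<rho>" .
    then show "B \<in> \<rho>"
      using pairings_unique[OF assms(2) B, of "{s, t}" s] s assms(3) by auto
  qed
qed fact

lemma insert_pairings:
  assumes "x \<in> U" "y \<in> U" "x \<noteq> y" "\<pi> \<in> pairings (U - {x, y})"
  shows "insert {x, y} \<pi> \<in> pairings U"
proof -
  have \<pi>: "U - {x, y} = \<Union>\<pi>" "disjoint \<pi>" "{} \<notin> \<pi>" "\<And>B. B \<in> \<pi> \<Longrightarrow> card B = 2"
    using assms(4) by (auto simp: pairings_def partition_on_def)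
  have "partition_on U (insert {x, y} \<pi>)"
  proof (rule partition_onI)
    show "\<Union>(insert {x, y} \<pi>) = U"
      using \<pi>(1) assms(1,2) by auto
    show "disjnt B C" if "B \<in> insert {x, y} \<pi>" "C \<in> insert {x, y} \<pi>" "B \<noteq> C" for B C
      using that \<pi>(1) disjointD[OF \<pi>(2), of B C] unfolding disjnt_def by blast
    show "{} \<notin> insert {x, y} \<pi>"
      using \<pi>(3) by simp
  qed
  then show ?thesis
    using \<pi>(4) assms(3) by (simp add: pairings_def)
qed

lemma pairings_insert:
  assumes "x \<in> U"
  shows "pairings U = (\<Union>y\<in>U - {x}. insert {x, y} ` pairings (U - {x, y}))"
proof (intro equalityI subsetI)
  fix \<pi> assume \<pi>: "\<pi> \<in> pairings U"
  from pairings_partner[OF this assms] obtain y where y: "y \<in> U" "y \<noteq> x" "{x, y} \<in> \<pi>" .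
  have "B \<inter> {x, y} = {}" if "B \<in> \<pi> - {{x, y}}" for B
    using pairings_unique[OF \<pi> _ y(3)] that by blast
  then have "\<pi> - {{x, y}} \<in> pairings (U - {x, y})"
    using \<pi> y(3) by (auto simp: pairings_def partition_on_def disjoint_def)
  then show "\<pi> \<in> (\<Union>y\<in>U - {x}. insert {x, y} ` pairings (U - {x, y}))"
    using y by (intro UN_I[of y] image_eqI[of _ _ "\<pi> - {{x, y}}"]) auto
next
  fix \<pi> assume "\<pi> \<in> (\<Union>y\<in>U - {x}. insert {x, y} ` pairings (U - {x, y}))"
  then show "\<pi> \<in> pairings U"
    using assms by (auto intro: insert_pairings)
qed

text \<open>Sorting the pairings by the partner \<open>y\<close> of \<open>x\<close> matches the sum
  over \<open>y\<close> that \<open>moment_split\<close> produces.\<close>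

lemma sum_pairings_insert:
  fixes f :: "'a set set \<Rightarrow> 'b::comm_monoid_add"
  assumes "finite U" "x \<in> U"
  shows "(\<Sum>\<pi>\<in>pairings U. f \<pi>) =
    (\<Sum>y\<in>U - {x}. \<Sum>\<pi>\<in>pairings (U - {x, y}). f (insert {x, y} \<pi>))"
proof -
  \<comment> \<open>The point \<open>x\<close> is covered by no block of \<open>\<pi>\<close>,
    whatever \<open>y\<close> and \<open>z\<close> are. This gives both the disjointness of the
    families and the injectivity of adding the block.\<close>
  have notin: "{x, y} \<notin> \<pi>" if "\<pi> \<in> pairings (U - {x, z})" for \<pi> y z
    using that by (auto simp: pairings_def partition_on_def)
  have "(\<Sum>\<pi>\<in>pairings U. f \<pi>) =
      (\<Sum>y\<in>U - {x}. sum f (insert {x, y} ` pairings (U - {x, y})))"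
    unfolding pairings_insert[OF assms(2)]
  proof (rule sum.UNION_disjoint)
    show "\<forall>y\<in>U - {x}. \<forall>z\<in>U - {x}. y \<noteq> z \<longrightarrow>
      insert {x, y} ` pairings (U - {x, y}) \<inter> insert {x, z} ` pairings (U - {x, z}) = {}"
    proof (intro ballI impI)
      fix y z assume yz: "y \<in> U - {x}" "z \<in> U - {x}" "y \<noteq> z"
      have "insert {x, y} \<pi> \<noteq> insert {x, z} \<pi>'"
        if "\<pi> \<in> pairings (U - {x, y})" "\<pi>' \<in> pairings (U - {x, z})" for \<pi> \<pi>'
      proof
        assume "insert {x, y} \<pi> = insert {x, z} \<pi>'"
        moreover have "{x, y} \<noteq> {x, z}"
          using yz by (auto simp: doubleton_eq_iff)
        ultimately have "{x, y} \<in> \<pi>'"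
          by blast
        then show False
          using notin that by blast
      qed
      then show "insert {x, y} ` pairings (U - {x, y}) \<inter> insert {x, z} ` pairings (U - {x, z}) = {}"
        by blast
    qed
  qed (use assms in \<open>auto simp: finite_pairings\<close>)
  also have "\<dots> = (\<Sum>y\<in>U - {x}. \<Sum>\<pi>\<in>pairings (U - {x, y}). f (insert {x, y} \<pi>))"
  proof (rule sum.cong[OF refl])
    fix y assume "y \<in> U - {x}"
    have "inj_on (insert {x, y}) (pairings (U - {x, y}))"
      using notin by (intro inj_onI) (metis insert_ident)
    then show "sum f (insert {x, y} ` pairings (U - {x, y})) =
        (\<Sum>\<pi>\<in>pairings (U - {x, y}). f (insert {x, y} \<pi>))"
      by (simp add: sum.reindex)
  qed
  finally show ?thesis .
qed

section \<open>Functions constant on blocks\<close>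

text \<open>The condition \<delta> = 1, for functions in place of lists and for any family of sets,
  since it is also needed for the connected components of two superposed pairings.\<close>

definition block_const :: "'a set set \<Rightarrow> ('a \<Rightarrow> 'b) \<Rightarrow> bool" where
  "block_const P i \<longleftrightarrow> (\<forall>B\<in>P. \<forall>s\<in>B. \<forall>t\<in>B. i s = i t)"

lemma block_constI:
  "(\<And>B s t. B \<in> P \<Longrightarrow> s \<in> B \<Longrightarrow> t \<in> B \<Longrightarrow> i s = i t) \<Longrightarrow> block_const P i"
  unfolding block_const_def by (intro ballI)

lemma block_constD:
  "block_const P i \<Longrightarrow> B \<in> P \<Longrightarrow> s \<in> B \<Longrightarrow> t \<in> B \<Longrightarrow> i s = i t"
  unfolding block_const_def by (drule (1) bspec, drule (1) bspec, drule (1) bspec)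

lemma block_const_insert_pair:
  "block_const (insert {x, y} \<pi>) i \<longleftrightarrow> i x = i y \<and> block_const \<pi> i"
proof
  assume *: "block_const (insert {x, y} \<pi>) i"
  have "i x = i y"
    by (rule block_constD[OF *, of "{x, y}"]) auto
  moreover have "block_const \<pi> i"
    by (intro block_constI block_constD[OF *]) auto
  ultimately show "i x = i y \<and> block_const \<pi> i" ..
next
  assume "i x = i y \<and> block_const \<pi> i"
  then show "block_const (insert {x, y} \<pi>) i"
    by (intro block_constI) (metis block_constD insertE singletonD)
qed

lemma block_const_cong:
  assumes "\<And>s. s \<in> \<Union>P \<Longrightarrow> i s = i' s"
  shows "block_const P i \<longleftrightarrow> block_const P i'"
  unfolding block_const_def using assms by (intro ball_cong refl) (metis UnionI)

lemma block_const_pairing_iff: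
  assumes "\<pi> \<in> pairings U"
  shows "block_const \<pi> i \<longleftrightarrow> (\<forall>s t. {s, t} \<in> \<pi> \<longrightarrow> i s = i t)"
proof
  assume *: "\<forall>s t. {s, t} \<in> \<pi> \<longrightarrow> i s = i t"
  show "block_const \<pi> i"
  proof (rule block_constI)
    fix B s t assume B: "B \<in> \<pi>" "s \<in> B" "t \<in> B"
    from pairings_block[OF assms B(1)] obtain x y where "B = {x, y}" .
    then have "{s, t} \<in> \<pi> \<or> s = t"
      using B by (auto simp: insert_commute)
    then show "i s = i t"
      using * by blast
  qed
next
  assume "block_const \<pi> i"
  then show "\<forall>s t. {s, t} \<in> \<pi> \<longrightarrow> i s = i t"
    by (intro allI impI block_constD[of \<pi> i "{_, _}"]) auto
qed

text \<open>Match greedily: a nonempty fibre of even size contains two points, and removing them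
  preserves all parities. Contrapositively, an index compatible with no pairing takes some value an
  odd number of times.\<close>

lemma even_fibres_imp_pairing:
  assumes "finite U" "\<And>a. even (card {s \<in> U. i s = a})"
  shows "\<exists>\<pi>\<in>pairings U. block_const \<pi> i"
  using assms
proof (induction U rule: finite_psubset_induct)
  case (psubset U)
  show ?case
  proof (cases "U = {}")
    case True
    then show ?thesis
      by (auto intro: block_constI)
  next
    case False
    then obtain x where x: "x \<in> U"
      by blast
    have "card {s \<in> U. i s = i x} \<noteq> 0"
      using x psubset.hyps by auto
    moreover have "even (card {s \<in> U. i s = i x})"
      by fact
    ultimately have "2 \<le> card {s \<in> U. i s = i x}"
      by presburger
    then have "\<not> {s \<in> U. i s = i x} \<subseteq> {x}"
      using card_mono[of "{x}" "{s \<in> U. i s = i x}"] by auto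
    then obtain y where y: "y \<in> U" "i y = i x" "y \<noteq> x"
      by auto
    have "even (card {s \<in> U - {x, y}. i s = a})" for a
    proof -
      have "card {s \<in> U. i s = a} = card {s \<in> U - {x, y}. i s = a} + (if a = i x then 2 else 0)"
      proof (cases "a = i x")
        case True
        have "{s \<in> U. i s = a} = insert x (insert y {s \<in> U - {x, y}. i s = a})"
          unfolding True using x y by blast
        then show ?thesis
          using True psubset.hyps y(3) by simp
      next
        case False
        then have "{s \<in> U. i s = a} = {s \<in> U - {x, y}. i s = a}"
          using y(2) by auto
        then show ?thesis
          using False by simp
      qed
      then show ?thesis
        using psubset.prems[of a] by (auto split: if_splits)
    qed
    then obtain \<pi> where "\<pi> \<in> pairings (U - {x, y})" "block_const \<pi> i"
      using psubset.IH[of "U - {x, y}"] x by auto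
    then show ?thesis
      using x y by (intro bexI[of _ "insert {x, y} \<pi>"])
        (auto simp: block_const_insert_pair intro: insert_pairings)
  qed
qed

text \<open>The standard index that takes equal values exactly on the blocks of \<pi>: a point is
  labelled by the smaller point of its block. The labels are points themselves, so they are
  admissible coordinates as soon as n > 2k.\<close>

definition pair_label :: "nat set set \<Rightarrow> nat \<Rightarrow> nat" where
  "pair_label \<pi> s = Min {t. t = s \<or> {s, t} \<in> \<pi>}"

lemma pair_label_eq_Min:
  assumes "\<pi> \<in> pairings U" "{s, t} \<in> \<pi>"
  shows "pair_label \<pi> s = Min {s, t}"
proof -
  have "{t'. t' = s \<or> {s, t'} \<in> \<pi>} = {s, t}"
    using assms(2) pairings_unique[OF assms(1) assms(2), of "{s, _}" s]
    by (auto simp: doubleton_eq_iff)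
  then show ?thesis
    by (simp add: pair_label_def)
qed

lemma pair_label_in:
  assumes "\<pi> \<in> pairings U" "s \<in> U"
  shows "pair_label \<pi> s \<in> U"
proof -
  from pairings_partner[OF assms] obtain t where "t \<in> U" "{s, t} \<in> \<pi>" .
  then show ?thesis
    using assms by (simp add: pair_label_eq_Min[of \<pi> U s t] min_def)
qed

text \<open>A label lies in the block of its point, so equal labels make two blocks meet and hence
  coincide.\<close>

lemma pair_label_eq_iff:
  assumes \<pi>: "\<pi> \<in> pairings U" and s: "s \<in> U" and t: "t \<in> U"
  shows "pair_label \<pi> s = pair_label \<pi> t \<longleftrightarrow> s = t \<or> {s, t} \<in> \<pi>"
proof -
  from pairings_partner[OF \<pi> s] obtain s' where s': "{s, s'} \<in> \<pi>" .
  from pairings_partner[OF \<pi> t] obtain t' where t': "{t, t'} \<in> \<pi>" .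
  have ls: "pair_label \<pi> s = Min {s, s'}" and lt: "pair_label \<pi> t = Min {t, t'}"
    using pair_label_eq_Min[OF \<pi>] s' t' by auto
  show ?thesis
  proof
    assume "pair_label \<pi> s = pair_label \<pi> t"
    then have "pair_label \<pi> s \<in> {s, s'}" "pair_label \<pi> s \<in> {t, t'}"
      using ls lt Min_in[of "{s, s'}"] Min_in[of "{t, t'}"] by auto
    then have "{s, s'} = {t, t'}"
      by (rule pairings_unique[OF \<pi> s' t'])
    then show "s = t \<or> {s, t} \<in> \<pi>"
      using s' by (auto simp: doubleton_eq_iff)
  next
    assume "s = t \<or> {s, t} \<in> \<pi>"
    then show "pair_label \<pi> s = pair_label \<pi> t"
      using pair_label_eq_Min[OF \<pi>, of s t] pair_label_eq_Min[OF \<pi>, of t s]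
      by (auto simp: insert_commute)
  qed
qed

text \<open>Constancy makes every block of \<rho> a block of \<tau>, and no pairing is properly
  contained in another one of the same set. This produces the identity matrix in the Gram
  relation.\<close>

lemma block_const_pair_label_iff:
  assumes "\<rho> \<in> pairings U" "\<tau> \<in> pairings U"
  shows "block_const \<rho> (pair_label \<tau>) \<longleftrightarrow> \<rho> = \<tau>"
proof
  assume *: "block_const \<rho> (pair_label \<tau>)"
  have "B \<in> \<tau>" if B: "B \<in> \<rho>" for B
  proof -
    from pairings_block[OF assms(1) B] obtain s t
      where st: "B = {s, t}" "s \<noteq> t" "s \<in> U" "t \<in> U" .
    have "pair_label \<tau> s = pair_label \<tau> t"
      using B st(1) by (intro block_constD[OF *, of B]) auto
    then show ?thesis
      using pair_label_eq_iff[OF assms(2) st(3,4)] st by auto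
  qed
  then show "\<rho> = \<tau>"
    by (intro pairings_subset_imp_eq[OF assms]) auto
next
  assume "\<rho> = \<tau>"
  have "pair_label \<tau> s = pair_label \<tau> t" if "{s, t} \<in> \<tau>" for s t
  proof -
    have "s \<in> U" "t \<in> U"
      using that assms(2) by (auto simp: pairings_def partition_on_def)
    then show ?thesis
      using pair_label_eq_iff[OF assms(2)] that by blast
  qed
  then show "block_const \<rho> (pair_label \<tau>)"
    using \<open>\<rho> = \<tau>\<close> by (auto simp: block_const_pairing_iff[OF assms(2)])
qed

text \<open>Functions on \<open>V\<close> that are constant on blocks correspond to functions on the
  set of blocks: evaluate at a chosen point of each block, and conversely compose with the block
  containing a point.\<close>

lemma sum_block_const:
  fixes f :: "('a \<Rightarrow> 'b) \<Rightarrow> 'c::comm_monoid_add"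
  assumes P: "partition_on V P"
  shows "(\<Sum>i\<in>{i \<in> V \<rightarrow>\<^sub>E N. block_const P i}. f i) =
    (\<Sum>h\<in>P \<rightarrow>\<^sub>E N. f (\<lambda>s\<in>V. h (THE B. B \<in> P \<and> s \<in> B)))"
proof -
  have the: "(THE B. B \<in> P \<and> s \<in> B) = B" if "B \<in> P" "s \<in> B" for s B
    using that P by (intro the_equality) (auto simp: partition_on_def disjoint_def)
  have some: "(SOME s. s \<in> B) \<in> B" if "B \<in> P" for B
    using that P by (intro some_in_eq[THEN iffD2]) (auto simp: partition_on_def)
  have sub: "s \<in> V" if "B \<in> P" "s \<in> B" for s B
    using that P by (auto simp: partition_on_def)
  have ex: "\<exists>B\<in>P. s \<in> B" if "s \<in> V" for s
    using that P by (auto simp: partition_on_def)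
  have inv: "(\<lambda>s\<in>V. (\<lambda>B\<in>P. i (SOME s. s \<in> B)) (THE B. B \<in> P \<and> s \<in> B)) = i"
    if i: "i \<in> {i \<in> V \<rightarrow>\<^sub>E N. block_const P i}" for i
    proof
      fix s
      show "(\<lambda>s\<in>V. (\<lambda>B\<in>P. i (SOME s. s \<in> B)) (THE B. B \<in> P \<and> s \<in> B)) s = i s"
      proof (cases "s \<in> V")
        case True
        with ex obtain B where B: "B \<in> P" "s \<in> B" by blast
        moreover have "i (SOME s. s \<in> B) = i s"
          using i B some[OF B(1)] by (intro block_constD[of P i B]) auto
        ultimately show ?thesis
          using True by (simp add: the)
      qed (use i in auto)
    qed
  show ?thesis
  proof (rule sum.reindex_bij_witness[where i = "\<lambda>h. \<lambda>s\<in>V. h (THE B. B \<in> P \<and> s \<in> B)"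
        and j = "\<lambda>i. \<lambda>B\<in>P. i (SOME s. s \<in> B)"], goal_cases)
    case (1 i)
    then show ?case
      by (rule inv)
  next
    case (2 i)
    then show ?case
      using some sub by (auto simp: PiE_def Pi_def)
  next
    case (3 h)
    show ?case
    proof
      fix B
      show "(\<lambda>B\<in>P. (\<lambda>s\<in>V. h (THE B. B \<in> P \<and> s \<in> B)) (SOME s. s \<in> B)) B = h B"
      proof (cases "B \<in> P")
        case True
        then show ?thesis
          using some[OF True] sub[OF True some[OF True]] the[OF True some[OF True]] by simp
      qed (use 3 in auto)
    qed
  next
    case (4 h)
    then have "h (THE B. B \<in> P \<and> s \<in> B) \<in> N" if "s \<in> V" for s
      using ex[OF that] by (auto simp: the)
    moreover have "block_const P (\<lambda>s\<in>V. h (THE B. B \<in> P \<and> s \<in> B))"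
      using the sub by (intro block_constI) auto
    ultimately show ?case
      by auto
  next
    case (5 i)
    then show ?case
      by (simp only: inv)
  qed
qed

lemma card_block_const:
  assumes "finite V" "partition_on V P"
  shows "card {i \<in> V \<rightarrow>\<^sub>E N. block_const P i} = card N ^ card P"
proof -
  have "card {i \<in> V \<rightarrow>\<^sub>E N. block_const P i} = (\<Sum>i\<in>{i \<in> V \<rightarrow>\<^sub>E N. block_const P i}. 1)"
    by simp
  also have "\<dots> = (\<Sum>h\<in>P \<rightarrow>\<^sub>E N. 1)"
    by (rule sum_block_const[OF assms(2)])
  also have "\<dots> = card N ^ card P"
    using finite_elements[OF assms] by (simp add: card_funcsetE)
  finally show ?thesis .
qed

subsection \<open>The metric of the Brauer space\<close>

lemma brauer_space_eq: "brauer_space k = pairings {..<2 * k}"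
  by (simp add: brauer_space_def pairings_def)

lemma finite_brauer_space: "finite (brauer_space k)"
  by (simp add: brauer_space_eq finite_pairings)

lemma delta_eq: "delta \<pi> xs = of_bool (block_const \<pi> ((!) xs))"
  unfolding delta_def block_const_def of_bool_def by (rule refl)

lemma card_pairing:
  assumes "\<pi> \<in> brauer_space k"
  shows "card \<pi> = k"
proof -
  have part: "partition_on {..<2 * k} \<pi>" and two: "\<And>B. B \<in> \<pi> \<Longrightarrow> card B = 2"
    using assms by (auto simp: brauer_space_def)
  have "card {..<2 * k} = (\<Sum>B\<in>\<pi>. card B)"
    using part by (intro product_partition) (auto simp: partition_on_def intro: finite_subset)
  then show ?thesis
    using two by simp
qed

text \<open>Being constant on the blocks of both pairings means being constant on the connected
  components. With n values this is a Gram matrix entry; other choices of \<open>N\<close> turn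
  statements about loops into counting arguments.\<close>

lemma card_block_const_two:
  assumes \<pi>: "\<pi> \<in> brauer_space k" and \<sigma>: "\<sigma> \<in> brauer_space k"
  shows "card {i \<in> {..<2 * k} \<rightarrow>\<^sub>E N. block_const \<pi> i \<and> block_const \<sigma> i} = card N ^ loops k \<pi> \<sigma>"
proof -
  define V where "V = {..<2 * k}"
  define R where "R = {(s, t). {s, t} \<in> \<pi> \<union> \<sigma>}"
  \<comment> \<open>The closure \<open>R\<^sup>*\<close> also relates every point outside
    \<open>V\<close> to itself. Restricting it gives an equivalence relation on \<open>V\<close>
    with the same classes there.\<close>
  define E where "E = R\<^sup>* \<inter> V \<times> V"
  have \<pi>V: "\<pi> \<in> pairings V" and \<sigma>V: "\<sigma> \<in> pairings V"
    using \<pi> \<sigma> by (auto simp: V_def brauer_space_eq)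
  have RV: "R \<subseteq> V \<times> V"
    using \<pi>V \<sigma>V by (auto simp: R_def pairings_def partition_on_def)
  have "sym R"
    by (auto simp: sym_def R_def insert_commute)
  then have sym: "sym (R\<^sup>*)"
    by (rule sym_rtrancl)
  have closed: "y \<in> V" if "(x, y) \<in> R\<^sup>*" "x \<in> V" for x y
    using that RV by (induction rule: rtrancl_induct) auto
  have "equiv V E"
  proof (rule equivI)
    show "E \<subseteq> V \<times> V" "refl_on V E"
      by (auto simp: E_def refl_on_def)
    show "sym E"
      using sym by (auto simp: E_def sym_def)
    show "trans E"
      by (auto simp: E_def trans_def)
  qed
  then have part: "partition_on V (V // E)"
    by (rule partition_on_quotient)
  have "E `` {x} = R\<^sup>* `` {x}" if "x \<in> V" for x
    using that closed by (auto simp: E_def)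
  then have quot: "V // E = V // R\<^sup>*"
    by (simp add: quotient_def)
  have "block_const (V // E) i \<longleftrightarrow> block_const \<pi> i \<and> block_const \<sigma> i" for i :: "nat \<Rightarrow> 'a"
  proof
    assume *: "block_const (V // E) i"
    have "i s = i t" if "{s, t} \<in> \<pi> \<union> \<sigma>" for s t
    proof (rule block_constD[OF *])
      have st: "(s, t) \<in> R"
        using that by (auto simp: R_def)
      then have "s \<in> V" "t \<in> V"
        using RV by auto
      then show "E `` {s} \<in> V // E" "s \<in> E `` {s}" "t \<in> E `` {s}"
        using st by (auto simp: E_def quotientI)
    qed
    then show "block_const \<pi> i \<and> block_const \<sigma> i"
      by (simp add: block_const_pairing_iff[OF \<pi>V] block_const_pairing_iff[OF \<sigma>V])
  next
    assume *: "block_const \<pi> i \<and> block_const \<sigma> i"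
    have step: "i s = i t" if "(s, t) \<in> R" for s t
      using that * block_const_pairing_iff[OF \<pi>V] block_const_pairing_iff[OF \<sigma>V]
      unfolding R_def by blast
    have path: "i x = i y" if "(x, y) \<in> R\<^sup>*" for x y
      using that by (induction rule: rtrancl_induct) (simp_all add: step)
    show "block_const (V // E) i"
    proof (rule block_constI)
      fix C s t assume "C \<in> V // E" "s \<in> C" "t \<in> C"
      then obtain x where "(x, s) \<in> E" "(x, t) \<in> E"
        by (auto simp: quotient_def)
      then show "i s = i t"
        using path[of x s] path[of x t] by (simp add: E_def)
    qed
  qed
  then have "{i \<in> V \<rightarrow>\<^sub>E N. block_const \<pi> i \<and> block_const \<sigma> i} = {i \<in> V \<rightarrow>\<^sub>E N. block_const (V // E) i}"
    by simp
  also have "card \<dots> = card N ^ card (V // E)"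
    by (rule card_block_const[OF _ part]) (simp add: V_def)
  finally show ?thesis
    unfolding quot unfolding loops_def R_def V_def .
qed

lemma card_block_const_pairing:
  assumes "\<pi> \<in> brauer_space k"
  shows "card {i \<in> {..<2 * k} \<rightarrow>\<^sub>E N. block_const \<pi> i} = card N ^ k"
  using card_block_const[of "{..<2 * k}" \<pi> N] assms card_pairing[OF assms]
  by (simp add: brauer_space_def)

lemma loops_self:
  assumes "\<pi> \<in> brauer_space k"
  shows "loops k \<pi> \<pi> = k"
  using card_block_const_two[OF assms assms, of "UNIV :: bool set"]
    card_block_const_pairing[OF assms, of "UNIV :: bool set"]
  by simp

lemma brauer_dist_self: "\<pi> \<in> brauer_space k \<Longrightarrow> brauer_dist k \<pi> \<pi> = 0"
  by (simp add: brauer_dist_def loops_self)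

text \<open>At distance 0 both counts of functions with values in \<open>V\<close> agree, so
  constancy on the blocks of \<pi> implies constancy on those of \<sigma>. The function
  \<open>pair_label \<pi>\<close> then forces the pairings to be equal; taking \<open>V\<close> as
  the set of values makes room for its labels.\<close>

lemma brauer_dist_pos:
  assumes \<pi>: "\<pi> \<in> brauer_space k" and \<sigma>: "\<sigma> \<in> brauer_space k" and "\<pi> \<noteq> \<sigma>"
  shows "brauer_dist k \<pi> \<sigma> > 0"
proof (rule ccontr)
  define V where "V = {..<2 * k}"
  assume "\<not> brauer_dist k \<pi> \<sigma> > 0"
  then have "loops k \<pi> \<sigma> = k"
    using loops_le[OF \<pi>, of \<sigma>] by (simp add: brauer_dist_def)
  then have "card {i \<in> V \<rightarrow>\<^sub>E V. block_const \<pi> i \<and> block_const \<sigma> i} = card {i \<in> V \<rightarrow>\<^sub>E V. block_const \<pi> i}"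
    unfolding V_def card_block_const_two[OF \<pi> \<sigma>] card_block_const_pairing[OF \<pi>] by simp
  then have eq: "{i \<in> V \<rightarrow>\<^sub>E V. block_const \<pi> i \<and> block_const \<sigma> i} = {i \<in> V \<rightarrow>\<^sub>E V. block_const \<pi> i}"
    by (intro card_subset_eq) (auto simp: V_def finite_PiE)
  have \<pi>V: "\<pi> \<in> pairings V" and \<sigma>V: "\<sigma> \<in> pairings V"
    using \<pi> \<sigma> by (auto simp: V_def brauer_space_eq)
  have un: "\<Union>\<pi> = V" "\<Union>\<sigma> = V"
    using \<pi>V \<sigma>V by (auto simp: pairings_def partition_on_def)
  let ?i = "restrict (pair_label \<pi>) V"
  have "?i \<in> V \<rightarrow>\<^sub>E V"
    using pair_label_in[OF \<pi>V] by auto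
  moreover have "block_const \<pi> ?i"
    using block_const_pair_label_iff[OF \<pi>V \<pi>V] un
    by (subst block_const_cong[of _ _ "pair_label \<pi>"]) auto
  ultimately have "block_const \<sigma> ?i"
    using eq by blast
  then have "block_const \<sigma> (pair_label \<pi>)"
    using un by (subst block_const_cong[of _ _ ?i]) auto
  then show False
    using block_const_pair_label_iff[OF \<sigma>V \<pi>V] \<open>\<pi> \<noteq> \<sigma>\<close> by simp
qed

text \<open>
  The functions \<open>V \<rightarrow> \<int>/2\<close> that are constant on the blocks of \<open>\<pi>\<close> and \<open>\<sigma>\<close>, respectively of \<open>\<sigma>\<close>
  and \<open>\<tau>\<close>, form subgroups \<open>X\<close> and \<open>Y\<close> of the group \<open>B\<close> of functions that are constant on the
  blocks of \<open>\<sigma>\<close>, hence \<open>|X| |Y| \<le> |B| |X \<inter> Y|\<close>.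
\<close>

lemma loops_triangle:
  assumes \<pi>: "\<pi> \<in> brauer_space k" and \<sigma>: "\<sigma> \<in> brauer_space k" and \<tau>: "\<tau> \<in> brauer_space k"
  shows "loops k \<pi> \<sigma> + loops k \<sigma> \<tau> \<le> k + loops k \<pi> \<tau>"
proof -
  define V where "V = {..<2 * k}"
  define F where "F = (V \<rightarrow>\<^sub>E (UNIV :: bool set))"
  define X where "X = {i \<in> F. block_const \<pi> i \<and> block_const \<sigma> i}"
  define Y where "Y = {i \<in> F. block_const \<sigma> i \<and> block_const \<tau> i}"
  define B where "B = {i \<in> F. block_const \<sigma> i}"
  define Z where "Z = {i \<in> F. block_const \<pi> i \<and> block_const \<tau> i}"
  \<comment> \<open>Exclusive or is addition modulo 2, so \<open>add\<close> also serves as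
    subtraction.\<close>
  define add where "add = (\<lambda>x y :: nat \<Rightarrow> bool. \<lambda>s\<in>V. x s \<noteq> y s)"
  have fin: "finite F"
    by (simp add: F_def V_def finite_PiE)
  have addF: "add x y \<in> F" for x y
    by (simp add: F_def add_def)
  have add_const: "block_const \<rho> (add x y)"
    if "\<rho> \<in> brauer_space k" "block_const \<rho> x" "block_const \<rho> y" for \<rho> x y
  proof (rule block_constI)
    fix C s t assume C: "C \<in> \<rho>" "s \<in> C" "t \<in> C"
    then have "s \<in> V" "t \<in> V"
      using that(1) by (auto simp: V_def brauer_space_def partition_on_def)
    then show "add x y s = add x y t"
      using block_constD[OF that(2) C] block_constD[OF that(3) C] by (simp add: add_def)
  qed
  \<comment> \<open>The X-component of one chosen representation of \<open>b\<close> as a sum from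
    \<open>X\<close> and \<open>Y\<close>.\<close>
  define x0 where "x0 = (\<lambda>b. SOME x. x \<in> X \<and> (\<exists>y\<in>Y. add x y = b))"
  have x0: "x0 (add x y) \<in> X" "\<exists>y'\<in>Y. add (x0 (add x y)) y' = add x y"
    if "x \<in> X" "y \<in> Y" for x y
  proof -
    have "x0 (add x y) \<in> X \<and> (\<exists>y'\<in>Y. add (x0 (add x y)) y' = add x y)"
      unfolding x0_def by (rule someI[of _ x]) (use that in blast)
    then show "x0 (add x y) \<in> X" "\<exists>y'\<in>Y. add (x0 (add x y)) y' = add x y"
      by auto
  qed
  \<comment> \<open>The cardinality bound comes from an injection: record the sum, and the deviation
    of \<open>x\<close> from the chosen component of that sum.\<close>
  define f where "f = (\<lambda>(x, y). (add x y, add x (x0 (add x y))))"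
  have cancel: "y = y'" if "add x y = add x y'" "y \<in> F" "y' \<in> F" for x y y'
  proof (rule PiE_ext[of y V _ y'])
    fix s assume "s \<in> V"
    then show "y s = y' s"
      using fun_cong[OF that(1), of s] by (auto simp: add_def)
  qed (use that in \<open>auto simp: F_def\<close>)
  have commute: "add x y = add y x" for x y
    by (auto simp: add_def fun_eq_iff restrict_def)
  have "inj_on f (X \<times> Y)"
  proof (rule inj_onI)
    fix p p' assume p: "p \<in> X \<times> Y" "p' \<in> X \<times> Y" "f p = f p'"
    obtain x y x' y' where eq: "p = (x, y)" "p' = (x', y')"
      by (cases p, cases p')
    have *: "add x y = add x' y'" "add x (x0 (add x y)) = add x' (x0 (add x y))"
      using p(3) by (auto simp: f_def eq)
    have F: "x \<in> F" "x' \<in> F" "y \<in> F" "y' \<in> F"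
      using p by (auto simp: eq X_def Y_def)
    have "x = x'"
      using *(2) F unfolding commute[of _ "x0 (add x y)"] by (blast intro: cancel)
    moreover from this have "y = y'"
      using *(1) F by (blast intro: cancel)
    ultimately show "p = p'"
      by (simp add: eq)
  qed
  moreover have "f ` (X \<times> Y) \<subseteq> B \<times> Z"
  proof
    fix q assume "q \<in> f ` (X \<times> Y)"
    then obtain x y where q: "q = f (x, y)" and xy: "x \<in> X" "y \<in> Y"
      by auto
    define b where "b = add x y"
    obtain y0 where y0: "y0 \<in> Y" "add (x0 b) y0 = b" and x0b: "x0 b \<in> X"
      using x0[OF xy] by (auto simp: b_def)
    \<comment> \<open>From x + y = x0 + y0 one gets x + x0 = y + y0. The left side is constant on
      the blocks of \<pi>, the right side on those of \<tau>, so the deviation lies in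
      \<open>Z\<close>.\<close>
    have "add x (x0 b) s = add y y0 s" for s
      using fun_cong[OF y0(2), of s] unfolding b_def by (auto simp: add_def split: if_splits)
    then have "add x (x0 b) = add y y0"
      by (rule ext)
    then have "add x (x0 b) \<in> Z"
      using add_const[OF \<pi>, of x "x0 b"] add_const[OF \<tau>, of y y0] xy y0 x0b addF
      by (auto simp: X_def Y_def Z_def)
    moreover have "b \<in> B"
      using add_const[OF \<sigma>, of x y] xy addF by (auto simp: b_def X_def Y_def B_def)
    ultimately show "q \<in> B \<times> Z"
      by (simp add: q f_def b_def)
  qed
  moreover have "finite (B \<times> Z)"
    using fin by (simp add: B_def Z_def)
  ultimately have "card (X \<times> Y) \<le> card (B \<times> Z)"
    by (rule card_inj_on_le)
  then have "2 ^ (loops k \<pi> \<sigma> + loops k \<sigma> \<tau>) \<le> (2 ^ (k + loops k \<pi> \<tau>) :: nat)"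
    using \<pi> \<sigma> \<tau>
    by (simp add: card_cartesian_product X_def Y_def B_def Z_def F_def V_def power_add
        card_block_const_two card_block_const_pairing)
  then show ?thesis
    by simp
qed

lemma brauer_dist_triangle:
  assumes "\<pi> \<in> brauer_space k" "\<sigma> \<in> brauer_space k" "\<tau> \<in> brauer_space k"
  shows "brauer_dist k \<pi> \<tau> \<le> brauer_dist k \<pi> \<sigma> + brauer_dist k \<sigma> \<tau>"
  using loops_triangle[OF assms] loops_le[OF assms(1), of \<sigma>] loops_le[OF assms(2), of \<tau>]
    loops_le[OF assms(1), of \<tau>]
  by (simp add: brauer_dist_def)

subsection \<open>Weingarten calculus\<close>

context orth_haar_measure
begin

text \<open>The invariant of the iteration: \<open>U\<close> holds the unmatched points,
  \<open>\<rho>\<close> the pairs that already received a fresh value, and \<open>ker\<close> says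
  that these values coincide only within their pair. Each application of \<open>moment_split\<close>
  moves a pair from \<open>U\<close> to \<open>\<rho>\<close>. Once \<open>U\<close> is empty,
  \<open>i\<close> has the coincidences of \<open>\<rho>\<close> and can be replaced by its
  labelling.\<close>

lemma moment_expand_unmatched:
  assumes n: "m < n" and j: "j \<in> {..<m} \<rightarrow> {..<n}"
    and U: "U \<subseteq> {..<m}" and i: "i \<in> {..<m} \<rightarrow> {..<n}" and \<rho>: "\<rho> \<in> pairings ({..<m} - U)"
    and ker: "\<And>s t. s < m \<Longrightarrow> t < m \<Longrightarrow> s \<notin> U \<or> t \<notin> U \<Longrightarrow> i s = i t \<longleftrightarrow> s = t \<or> {s, t} \<in> \<rho>"
  shows "moment M m i j =
    (\<Sum>\<pi>\<in>pairings U. of_bool (block_const \<pi> i) * moment M m (pair_label (\<pi> \<union> \<rho>)) j)"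
  using U i \<rho> ker
proof (induction "card U" arbitrary: U i \<rho> rule: less_induct)
  case less
  have finU: "finite U"
    using less.prems(1) finite_subset by blast
  show ?case
  proof (cases "U = {}")
    case True
    have \<rho>: "\<rho> \<in> pairings {..<m}"
      using less.prems(3) True by simp
    have "pair_label \<rho> \<in> {..<m} \<rightarrow> {..<n}"
      using pair_label_in[OF \<rho>] n by fastforce
    moreover have "i s = i t \<longleftrightarrow> pair_label \<rho> s = pair_label \<rho> t" if "s < m" "t < m" for s t
      using less.prems(4)[OF that] pair_label_eq_iff[OF \<rho>, of s t] that True by simp
    ultimately have "moment M m i j = moment M m (pair_label \<rho>) j"
      using less.prems(2) j by (intro moment_kernel_cong)
    moreover have "block_const {} i"
      by (rule block_constI) simp
    ultimately show ?thesis
      by (simp add: True)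
  next
    case False
    then obtain x where x: "x \<in> U"
      by blast
    then have xm: "x < m"
      using less.prems(1) by auto
    \<comment> \<open>At most \<open>m\<close> of the \<open>n\<close> values occur, so a fresh one
      exists.\<close>
    have "card (i ` {..<m}) < card {..<n}"
      using card_image_le[of "{..<m}" i] n by simp
    then have "\<not> {..<n} \<subseteq> i ` {..<m}"
      using card_mono[of "i ` {..<m}" "{..<n}"] by auto
    then obtain b where b: "b < n" "b \<notin> i ` {..<m}"
      by auto
    have "{x} \<inter> \<Union>\<rho> = {}"
      using less.prems(3) x by (auto simp: pairings_def partition_on_def)
    then have "y \<in> U" if "y < m" "y \<noteq> x" "i y = i x" for y
      using less.prems(4)[OF that(1) xm] that x by blast
    then have ys: "{y \<in> {..<m} - {x}. i y = i x} = {y \<in> U - {x}. i y = i x}"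
      using less.prems(1) by auto
    have step: "moment M m (i(x := b, y := b)) j = (\<Sum>\<pi>\<in>pairings (U - {x, y}).
        of_bool (block_const \<pi> i) * moment M m (pair_label (insert {x, y} \<pi> \<union> \<rho>)) j)"
      if y: "y \<in> U - {x}" for y
    proof -
      let ?i = "i(x := b, y := b)" and ?U = "U - {x, y}" and ?\<rho> = "insert {x, y} \<rho>"
      have ym: "y < m"
        using y less.prems(1) by auto
      have disj: "{x, y} \<inter> \<Union>\<rho> = {}"
        using less.prems(3) x y by (auto simp: pairings_def partition_on_def)
      have b': "i s \<noteq> b" if "s < m" for s
        using b(2) that by blast
      have "moment M m ?i j = (\<Sum>\<pi>\<in>pairings ?U.
          of_bool (block_const \<pi> ?i) * moment M m (pair_label (\<pi> \<union> ?\<rho>)) j)"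
      proof (rule less.hyps)
        show "card ?U < card U"
          using finU x by (intro psubset_card_mono) auto
        show "?U \<subseteq> {..<m}" "?i \<in> {..<m} \<rightarrow> {..<n}"
          using less.prems(1,2) b(1) by auto
        have "{..<m} - U = ({..<m} - ?U) - {x, y}"
          using x y by auto
        then show "?\<rho> \<in> pairings ({..<m} - ?U)"
          using less.prems(3) x y xm ym by (intro insert_pairings) auto
        show "?i s = ?i t \<longleftrightarrow> s = t \<or> {s, t} \<in> ?\<rho>"
          if st: "s < m" "t < m" "s \<notin> ?U \<or> t \<notin> ?U" for s t
        proof (cases "s \<in> {x, y} \<or> t \<in> {x, y}")
          case True
          then have "{s, t} \<notin> \<rho>"
            using disj by blast
          moreover have "?i s = ?i t \<longleftrightarrow> s \<in> {x, y} \<and> t \<in> {x, y}"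
            using True b'[OF st(1)] b'[OF st(2)] by auto
          ultimately show ?thesis
            using True by (auto simp: doubleton_eq_iff)
        next
          case False
          then have "{s, t} \<noteq> {x, y}" "s \<notin> U \<or> t \<notin> U"
            using st(3) by (auto simp: doubleton_eq_iff)
          then show ?thesis
            using False less.prems(4)[OF st(1,2)] by simp
        qed
      qed
      also have "\<dots> = (\<Sum>\<pi>\<in>pairings ?U.
          of_bool (block_const \<pi> i) * moment M m (pair_label (insert {x, y} \<pi> \<union> \<rho>)) j)"
      proof (rule sum.cong[OF refl])
        fix \<pi> assume "\<pi> \<in> pairings ?U"
        then have "block_const \<pi> ?i \<longleftrightarrow> block_const \<pi> i"
          by (intro block_const_cong) (auto simp: pairings_def partition_on_def)
        then show "of_bool (block_const \<pi> ?i) * moment M m (pair_label (\<pi> \<union> ?\<rho>)) j =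
            of_bool (block_const \<pi> i) * moment M m (pair_label (insert {x, y} \<pi> \<union> \<rho>)) j"
          by simp
      qed
      finally show ?thesis .
    qed
    have "moment M m i j = (\<Sum>y\<in>{y \<in> U - {x}. i y = i x}. moment M m (i(x := b, y := b)) j)"
      unfolding ys[symmetric] by (rule moment_split[OF less.prems(2) j xm b])
    also have "\<dots> = (\<Sum>y\<in>{y \<in> U - {x}. i y = i x}. \<Sum>\<pi>\<in>pairings (U - {x, y}).
        of_bool (block_const \<pi> i) * moment M m (pair_label (insert {x, y} \<pi> \<union> \<rho>)) j)"
      by (intro sum.cong refl step) auto
    also have "\<dots> = (\<Sum>y\<in>U - {x}. if i y = i x then \<Sum>\<pi>\<in>pairings (U - {x, y}).
        of_bool (block_const \<pi> i) * moment M m (pair_label (insert {x, y} \<pi> \<union> \<rho>)) j else 0)"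
      using finU by (intro sum.inter_filter) auto
    \<comment> \<open>For \<open>i y \<noteq> i x\<close> the added block is not constant, so these
      terms vanish and \<open>y\<close> may range over all of \<open>U - {x}\<close>.\<close>
    also have "\<dots> = (\<Sum>y\<in>U - {x}. \<Sum>\<pi>\<in>pairings (U - {x, y}).
        of_bool (block_const (insert {x, y} \<pi>) i) * moment M m (pair_label (insert {x, y} \<pi> \<union> \<rho>)) j)"
      by (intro sum.cong refl) (auto simp: block_const_insert_pair)
    also have "\<dots> = (\<Sum>\<pi>\<in>pairings U. of_bool (block_const \<pi> i) * moment M m (pair_label (\<pi> \<union> \<rho>)) j)"
      by (rule sum_pairings_insert[OF finU x, symmetric])
    finally show ?thesis .
  qed
qed

lemma moment_expand:
  assumes "m < n" "i \<in> {..<m} \<rightarrow> {..<n}" "j \<in> {..<m} \<rightarrow> {..<n}"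
  shows "moment M m i j =
    (\<Sum>\<pi>\<in>pairings {..<m}. of_bool (block_const \<pi> i) * moment M m (pair_label \<pi>) j)"
proof -
  have "{} \<in> pairings ({..<m} - {..<m})"
    by simp
  from moment_expand_unmatched[OF assms(1,3) subset_refl assms(2) this] show ?thesis
    unfolding Un_empty_right by (metis lessThan_iff)
qed

text \<open>The identity holds for each orthogonal \<open>u\<close> before integration. The sum
  factors over the blocks, and a block \<open>{s, t}\<close> contributes the inner product of the
  columns \<open>j s\<close> and \<open>j t\<close>.\<close>

lemma sum_moment_block_const:
  assumes \<rho>: "\<rho> \<in> pairings {..<m}" and j: "j \<in> {..<m} \<rightarrow> {..<n}"
  shows "(\<Sum>i\<in>{i \<in> {..<m} \<rightarrow>\<^sub>E {..<n}. block_const \<rho> i}. moment M m i j) = of_bool (block_const \<rho> j)"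
proof -
  have part: "partition_on {..<m} \<rho>"
    using \<rho> by (simp add: pairings_def)
  then have un: "\<Union>\<rho> = {..<m}" and fin: "finite \<rho>"
    using finite_elements[OF _ part] by (auto simp: partition_on_def)
  have finB: "finite B" if "B \<in> \<rho>" for B
    using that un by (metis Union_upper finite_lessThan finite_subset)
  have the: "(THE B. B \<in> \<rho> \<and> s \<in> B) = B" if "B \<in> \<rho>" "s \<in> B" for s B
    using that pairings_unique[OF \<rho>] by (intro the_equality) auto
  have int: "(\<Sum>i\<in>{i \<in> {..<m} \<rightarrow>\<^sub>E {..<n}. block_const \<rho> i}. \<Prod>s<m. u $$ (i s, j s)) =
      of_bool (block_const \<rho> j)" if u: "u \<in> orth_group n" for u
  proof -
    have "(\<Sum>i\<in>{i \<in> {..<m} \<rightarrow>\<^sub>E {..<n}. block_const \<rho> i}. \<Prod>s<m. u $$ (i s, j s)) =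
        (\<Sum>h\<in>\<rho> \<rightarrow>\<^sub>E {..<n}. \<Prod>s<m. u $$ ((\<lambda>s\<in>{..<m}. h (THE B. B \<in> \<rho> \<and> s \<in> B)) s, j s))"
      by (rule sum_block_const[OF part])
    also have "\<dots> = (\<Sum>h\<in>\<rho> \<rightarrow>\<^sub>E {..<n}. \<Prod>B\<in>\<rho>. \<Prod>s\<in>B. u $$ (h B, j s))"
    proof (rule sum.cong[OF refl])
      fix h assume "h \<in> \<rho> \<rightarrow>\<^sub>E {..<n}"
      have "(\<Prod>s<m. u $$ ((\<lambda>s\<in>{..<m}. h (THE B. B \<in> \<rho> \<and> s \<in> B)) s, j s)) =
          (\<Prod>s\<in>\<Union>\<rho>. u $$ (h (THE B. B \<in> \<rho> \<and> s \<in> B), j s))"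
        unfolding un by (intro prod.cong) auto
      also have "\<dots> = (\<Prod>B\<in>\<rho>. \<Prod>s\<in>B. u $$ (h (THE B. B \<in> \<rho> \<and> s \<in> B), j s))"
        using finB part unfolding partition_on_def
        by (subst prod.Union_disjoint) (auto simp: disjoint_def)
      also have "\<dots> = (\<Prod>B\<in>\<rho>. \<Prod>s\<in>B. u $$ (h B, j s))"
        by (intro prod.cong refl) (simp add: the)
      finally show "(\<Prod>s<m. u $$ ((\<lambda>s\<in>{..<m}. h (THE B. B \<in> \<rho> \<and> s \<in> B)) s, j s)) =
          (\<Prod>B\<in>\<rho>. \<Prod>s\<in>B. u $$ (h B, j s))" .
    qed
    also have "\<dots> = (\<Prod>B\<in>\<rho>. \<Sum>l<n. \<Prod>s\<in>B. u $$ (l, j s))"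
      using fin by (simp add: prod_sum_PiE)
    also have "\<dots> = (\<Prod>B\<in>\<rho>. of_bool (\<forall>s\<in>B. \<forall>t\<in>B. j s = j t))"
    proof (rule prod.cong[OF refl])
      fix B assume "B \<in> \<rho>"
      from pairings_block[OF \<rho> this] obtain s t
        where B: "B = {s, t}" "s \<noteq> t" and st: "s \<in> {..<m}" "t \<in> {..<m}" .
      have "(\<Sum>l<n. \<Prod>s\<in>B. u $$ (l, j s)) = (\<Sum>l<n. u $$ (l, j s) * u $$ (l, j t))"
        using B by simp
      also have "\<dots> = of_bool (j s = j t)"
        using u st j by (auto simp: orth_group_iff Pi_def)
      also have "j s = j t \<longleftrightarrow> (\<forall>s\<in>B. \<forall>t\<in>B. j s = j t)"
        using B by auto
      finally show "(\<Sum>l<n. \<Prod>s\<in>B. u $$ (l, j s)) = of_bool (\<forall>s\<in>B. \<forall>t\<in>B. j s = j t)" .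
    qed
    also have "\<dots> = of_bool (block_const \<rho> j)"
    proof -
      have "(\<Prod>B\<in>\<rho>. of_bool (P B)) = (of_bool (\<forall>B\<in>\<rho>. P B) :: real)" for P
        using fin by (induction rule: finite_induct) auto
      then show ?thesis
        unfolding block_const_def .
    qed
    finally show ?thesis .
  qed
  have "(\<Sum>i\<in>{i \<in> {..<m} \<rightarrow>\<^sub>E {..<n}. block_const \<rho> i}. moment M m i j) =
      (LINT u|M. (\<Sum>i\<in>{i \<in> {..<m} \<rightarrow>\<^sub>E {..<n}. block_const \<rho> i}. \<Prod>s<m. u $$ (i s, j s)))"
    unfolding moment_def using j
    by (intro Bochner_Integration.integral_sum[symmetric] integrable_monomial) auto
  also have "\<dots> = (LINT u|M. of_bool (block_const \<rho> j))"
    by (intro Bochner_Integration.integral_cong refl int) (simp add: space_eq)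
  finally show ?thesis
    by (simp add: prob_space)
qed

section \<open>The Weingarten matrix as the inverse of the Gram matrix\<close>

definition weingarten :: "nat \<Rightarrow> nat set set \<Rightarrow> nat set set \<Rightarrow> real" where
  "weingarten k \<pi> \<sigma> = moment M (2 * k) (pair_label \<pi>) (pair_label \<sigma>)"

lemma pair_label_less:
  assumes "2 * k < n" "\<pi> \<in> brauer_space k"
  shows "pair_label \<pi> \<in> {..<2 * k} \<rightarrow> {..<n}"
  using assms pair_label_in[of \<pi> "{..<2 * k}"] by (fastforce simp: brauer_space_eq)

lemma abs_weingarten_le_1:
  assumes "2 * k < n" "\<pi> \<in> brauer_space k" "\<sigma> \<in> brauer_space k"
  shows "\<bar>weingarten k \<pi> \<sigma>\<bar> \<le> 1"
  unfolding weingarten_def using assms by (intro abs_moment_le_1 pair_label_less)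

text \<open>Expand in the row index, exchange rows and columns by \<open>moment_commute\<close>, and
  expand again.\<close>

lemma moment_eq_weingarten:
  assumes n: "2 * k < n" and i: "i \<in> {..<2 * k} \<rightarrow> {..<n}" and j: "j \<in> {..<2 * k} \<rightarrow> {..<n}"
  shows "moment M (2 * k) i j =
    (\<Sum>\<pi>\<in>{\<pi> \<in> brauer_space k. block_const \<pi> i}. \<Sum>\<sigma>\<in>{\<sigma> \<in> brauer_space k. block_const \<sigma> j}.
      weingarten k \<pi> \<sigma>)"
proof -
  have "moment M (2 * k) (pair_label \<pi>) j =
      (\<Sum>\<sigma>\<in>{\<sigma> \<in> brauer_space k. block_const \<sigma> j}. weingarten k \<pi> \<sigma>)"
    if \<pi>: "\<pi> \<in> brauer_space k" for \<pi>
  proof -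
    note l = pair_label_less[OF n]
    have "moment M (2 * k) (pair_label \<pi>) j = moment M (2 * k) j (pair_label \<pi>)"
      by (rule moment_commute[OF l[OF \<pi>] j])
    also have "\<dots> = (\<Sum>\<sigma>\<in>brauer_space k.
        of_bool (block_const \<sigma> j) * moment M (2 * k) (pair_label \<sigma>) (pair_label \<pi>))"
      unfolding brauer_space_eq by (rule moment_expand[OF n j l[OF \<pi>]])
    also have "\<dots> = (\<Sum>\<sigma>\<in>brauer_space k. if block_const \<sigma> j then weingarten k \<pi> \<sigma> else 0)"
      using l \<pi> by (intro sum.cong refl) (auto simp: weingarten_def moment_commute)
    also have "\<dots> = (\<Sum>\<sigma>\<in>{\<sigma> \<in> brauer_space k. block_const \<sigma> j}. weingarten k \<pi> \<sigma>)"
      by (rule sum.inter_filter[symmetric]) (rule finite_brauer_space)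
    finally show ?thesis .
  qed
  note * = this
  have "moment M (2 * k) i j =
      (\<Sum>\<pi>\<in>brauer_space k. if block_const \<pi> i then moment M (2 * k) (pair_label \<pi>) j else 0)"
    unfolding brauer_space_eq moment_expand[OF n i j] by (intro sum.cong) auto
  also have "\<dots> = (\<Sum>\<pi>\<in>{\<pi> \<in> brauer_space k. block_const \<pi> i}. moment M (2 * k) (pair_label \<pi>) j)"
    by (rule sum.inter_filter[symmetric]) (rule finite_brauer_space)
  finally show ?thesis
    using * by simp
qed

text \<open>Sum the moments at \<open>i\<close> and \<open>pair_label \<tau>\<close> over all
  \<open>i\<close> constant on the blocks of \<rho>. Expanding each of them counts the
  \<open>i\<close> compatible with both \<rho> and \<pi>, which is a Gram entry; column
  orthogonality evaluates the same sum to 0 or 1.\<close>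

lemma gram_weingarten:
  assumes n: "2 * k < n" and \<rho>: "\<rho> \<in> brauer_space k" and \<tau>: "\<tau> \<in> brauer_space k"
  shows "(\<Sum>\<pi>\<in>brauer_space k. real n ^ loops k \<rho> \<pi> * weingarten k \<pi> \<tau>) = of_bool (\<rho> = \<tau>)"
proof -
  define V where "V = {..<2 * k}"
  define I where "I = {i \<in> V \<rightarrow>\<^sub>E {..<n}. block_const \<rho> i}"
  have fin: "finite I"
    by (simp add: I_def V_def finite_PiE)
  have "(\<Sum>\<pi>\<in>brauer_space k. real n ^ loops k \<rho> \<pi> * weingarten k \<pi> \<tau>) =
      (\<Sum>\<pi>\<in>brauer_space k. \<Sum>i\<in>I. of_bool (block_const \<pi> i) * weingarten k \<pi> \<tau>)"
  proof (rule sum.cong[OF refl])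
    fix \<pi> assume \<pi>: "\<pi> \<in> brauer_space k"
    have "(\<Sum>i\<in>I. of_bool (block_const \<pi> i) * weingarten k \<pi> \<tau>) =
        real (card {i \<in> I. block_const \<pi> i}) * weingarten k \<pi> \<tau>"
      using fin by (simp add: sum_distrib_right[symmetric] Int_def)
    also have "{i \<in> I. block_const \<pi> i} = {i \<in> V \<rightarrow>\<^sub>E {..<n}. block_const \<rho> i \<and> block_const \<pi> i}"
      by (auto simp: I_def)
    also have "card \<dots> = n ^ loops k \<rho> \<pi>"
      using card_block_const_two[OF \<rho> \<pi>, of "{..<n}"] by (simp add: V_def)
    finally show "real n ^ loops k \<rho> \<pi> * weingarten k \<pi> \<tau> =
        (\<Sum>i\<in>I. of_bool (block_const \<pi> i) * weingarten k \<pi> \<tau>)"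
      by simp
  qed
  also have "\<dots> = (\<Sum>i\<in>I. \<Sum>\<pi>\<in>brauer_space k. of_bool (block_const \<pi> i) * weingarten k \<pi> \<tau>)"
    by (rule sum.swap)
  also have "\<dots> = (\<Sum>i\<in>I. moment M (2 * k) i (pair_label \<tau>))"
  proof (rule sum.cong[OF refl])
    fix i assume "i \<in> I"
    then have "i \<in> {..<2 * k} \<rightarrow> {..<n}"
      by (auto simp: I_def V_def PiE_def)
    from moment_expand[OF n this pair_label_less[OF n \<tau>]]
    show "(\<Sum>\<pi>\<in>brauer_space k. of_bool (block_const \<pi> i) * weingarten k \<pi> \<tau>) =
        moment M (2 * k) i (pair_label \<tau>)"
      by (simp add: weingarten_def brauer_space_eq)
  qed
  also have "\<dots> = of_bool (block_const \<rho> (pair_label \<tau>))"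
    unfolding I_def V_def using \<rho>
    by (intro sum_moment_block_const pair_label_less[OF n \<tau>]) (simp add: brauer_space_eq)
  also have "block_const \<rho> (pair_label \<tau>) \<longleftrightarrow> \<rho> = \<tau>"
    using \<rho> \<tau> by (intro block_const_pair_label_iff) (auto simp: brauer_space_eq)
  finally show ?thesis .
qed

end

subsection \<open>Path expansion\<close>

text \<open>Fixing the start and the number of steps gives finite sets and a recursion on the first
  step.\<close>

definition paths_from :: "nat \<Rightarrow> nat set set \<Rightarrow> nat \<Rightarrow> nat set set list set" where
  "paths_from k \<rho> r = {p. brauer_path k p \<and> hd p = \<rho> \<and> path_steps p = r}"

lemma paths_from_0:
  assumes "\<rho> \<in> brauer_space k"
  shows "paths_from k \<rho> 0 = {[\<rho>]}"
proof -
  have "p = [\<rho>]" if "p \<in> paths_from k \<rho> 0" for p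
    using that by (cases p) (auto simp: paths_from_def brauer_path_def path_steps_def)
  then show ?thesis
    using assms by (auto simp: paths_from_def brauer_path_def path_steps_def)
qed

lemma paths_from_Suc:
  assumes \<rho>: "\<rho> \<in> brauer_space k"
  shows "paths_from k \<rho> (Suc r) = (\<Union>\<pi>\<in>brauer_space k - {\<rho>}. (#) \<rho> ` paths_from k \<pi> r)"
proof (intro equalityI subsetI)
  fix p assume p: "p \<in> paths_from k \<rho> (Suc r)"
  then obtain \<pi> ps where eq: "p = \<rho> # \<pi> # ps"
    by (cases p rule: list.exhaust; cases "tl p")
       (auto simp: paths_from_def brauer_path_def path_steps_def)
  have "\<pi> # ps \<in> paths_from k \<pi> r" "\<pi> \<in> brauer_space k - {\<rho>}"
    using p by (auto simp: eq paths_from_def brauer_path_def path_steps_def)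
  then show "p \<in> (\<Union>\<pi>\<in>brauer_space k - {\<rho>}. (#) \<rho> ` paths_from k \<pi> r)"
    unfolding eq by blast
next
  fix p assume "p \<in> (\<Union>\<pi>\<in>brauer_space k - {\<rho>}. (#) \<rho> ` paths_from k \<pi> r)"
  then obtain \<pi> ps where \<pi>: "\<pi> \<in> brauer_space k - {\<rho>}" and ps: "ps \<in> paths_from k \<pi> r"
    and eq: "p = \<rho> # ps"
    by blast
  then show "p \<in> paths_from k \<rho> (Suc r)"
    using \<rho> by (cases ps) (auto simp: paths_from_def brauer_path_def path_steps_def)
qed

lemma finite_paths_from:
  assumes "\<rho> \<in> brauer_space k"
  shows "finite (paths_from k \<rho> r)"
  using assms
  by (induction r arbitrary: \<rho>) (auto simp: paths_from_0 paths_from_Suc finite_brauer_space)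

lemma path_length_singleton [simp]: "path_length k [\<rho>] = 0"
  by (simp add: path_length_def path_steps_def)

lemma path_length_Cons:
  assumes "p \<noteq> []"
  shows "path_length k (\<rho> # p) = brauer_dist k \<rho> (hd p) + path_length k p"
proof -
  have "length p = Suc (length p - 1)"
    using assms by (cases p) auto
  then have "path_length k (\<rho> # p) =
      (\<Sum>m<Suc (length p - 1). brauer_dist k ((\<rho> # p) ! m) ((\<rho> # p) ! Suc m))"
    by (simp add: path_length_def path_steps_def)
  also have "\<dots> = brauer_dist k \<rho> (hd p) + path_length k p"
    using assms by (subst sum.lessThan_Suc_shift) (simp add: path_length_def path_steps_def hd_conv_nth)
  finally show ?thesis .
qed

lemma brauer_path_Cons:
  assumes "p \<noteq> []"
  shows "brauer_path k (\<rho> # p) \<longleftrightarrow> \<rho> \<in> brauer_space k \<and> \<rho> \<noteq> hd p \<and> brauer_path k p"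
  using assms by (cases p) (auto simp: brauer_path_def)

lemma brauer_path_ends:
  assumes "brauer_path k p"
  shows "hd p \<in> brauer_space k" "last p \<in> brauer_space k"
  using assms hd_in_set[of p] last_in_set[of p] by (auto simp: brauer_path_def)

text \<open>Each step has length at least 1. So short paths have few steps, and paths with many
  steps have small weight.\<close>

lemma path_steps_le_length:
  assumes "brauer_path k p"
  shows "path_steps p \<le> path_length k p"
  using assms
proof (induction p)
  case Nil
  then show ?case by (simp add: path_steps_def)
next
  case (Cons \<rho> p)
  show ?case
  proof (cases "p = []")
    case False
    then have \<rho>: "\<rho> \<in> brauer_space k" "\<rho> \<noteq> hd p" "brauer_path k p"
      using Cons.prems by (auto simp: brauer_path_Cons)
    have "brauer_dist k \<rho> (hd p) > 0"
      using \<rho> brauer_path_ends(1)[OF \<rho>(3)] by (intro brauer_dist_pos)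
    moreover have "path_steps (\<rho> # p) = Suc (path_steps p)"
      using False by (cases p) (auto simp: path_steps_def)
    ultimately show ?thesis
      using Cons.IH[OF \<rho>(3)] False by (simp add: path_length_Cons)
  qed (simp add: path_steps_def)
qed

lemma brauer_dist_le_path_length:
  assumes "brauer_path k p"
  shows "brauer_dist k (hd p) (last p) \<le> path_length k p"
  using assms
proof (induction p)
  case Nil
  then show ?case by (simp add: brauer_path_def)
next
  case (Cons \<rho> p)
  show ?case
  proof (cases "p = []")
    case False
    then have \<rho>: "\<rho> \<in> brauer_space k" "brauer_path k p"
      using Cons.prems by (auto simp: brauer_path_Cons)
    show ?thesis
      using Cons.IH[OF \<rho>(2)] False
        brauer_dist_triangle[OF \<rho>(1) brauer_path_ends[OF \<rho>(2)]]
      by (simp add: path_length_Cons)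
  next
    case True
    then show ?thesis
      using Cons.prems by (simp add: brauer_path_def brauer_dist_self)
  qed
qed

section \<open>The truncated Neumann series\<close>

text \<open>The value at \<rho> of (-\<Lambda>)^r f, where \<Lambda> has zero diagonal and entries
  x^(-d) elsewhere: multiplying out the matrix power gives the paths with r steps.\<close>

definition path_sum ::
  "nat \<Rightarrow> real \<Rightarrow> (nat set set \<Rightarrow> real) \<Rightarrow> nat \<Rightarrow> nat set set \<Rightarrow> real" where
  "path_sum k x f r \<rho> = (\<Sum>p\<in>paths_from k \<rho> r. (-1) ^ r / x ^ path_length k p * f (last p))"

lemma path_sum_0: "\<rho> \<in> brauer_space k \<Longrightarrow> path_sum k x f 0 \<rho> = f \<rho>"
  by (simp add: path_sum_def paths_from_0)

lemma path_sum_Suc: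
  assumes \<rho>: "\<rho> \<in> brauer_space k"
  shows "path_sum k x f (Suc r) \<rho> =
    - (\<Sum>\<pi>\<in>brauer_space k - {\<rho>}. path_sum k x f r \<pi> / x ^ brauer_dist k \<rho> \<pi>)"
proof -
  have "path_sum k x f (Suc r) \<rho> = (\<Sum>\<pi>\<in>brauer_space k - {\<rho>}.
      \<Sum>p\<in>(#) \<rho> ` paths_from k \<pi> r. (-1) ^ Suc r / x ^ path_length k p * f (last p))"
    unfolding path_sum_def paths_from_Suc[OF \<rho>]
  proof (rule sum.UNION_disjoint)
    show "\<forall>\<pi>\<in>brauer_space k - {\<rho>}. \<forall>\<sigma>\<in>brauer_space k - {\<rho>}. \<pi> \<noteq> \<sigma> \<longrightarrow>
        (#) \<rho> ` paths_from k \<pi> r \<inter> (#) \<rho> ` paths_from k \<sigma> r = {}"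
      by (auto simp: paths_from_def)
  qed (auto simp: finite_brauer_space finite_paths_from)
  also have "\<dots> = (\<Sum>\<pi>\<in>brauer_space k - {\<rho>}. - (path_sum k x f r \<pi> / x ^ brauer_dist k \<rho> \<pi>))"
  proof (rule sum.cong[OF refl])
    fix \<pi>
    have "(\<Sum>p\<in>(#) \<rho> ` paths_from k \<pi> r. (-1) ^ Suc r / x ^ path_length k p * f (last p)) =
        (\<Sum>p\<in>paths_from k \<pi> r. (-1) ^ Suc r / x ^ path_length k (\<rho> # p) * f (last (\<rho> # p)))"
      by (subst sum.reindex) auto
    also have "\<dots> = (\<Sum>p\<in>paths_from k \<pi> r.
        - ((-1) ^ r / x ^ path_length k p * f (last p) / x ^ brauer_dist k \<rho> \<pi>))"
      by (intro sum.cong) (auto simp: paths_from_def brauer_path_def path_length_Cons power_add)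
    finally show "(\<Sum>p\<in>(#) \<rho> ` paths_from k \<pi> r. (-1) ^ Suc r / x ^ path_length k p * f (last p)) =
        - (path_sum k x f r \<pi> / x ^ brauer_dist k \<rho> \<pi>)"
      by (simp add: path_sum_def sum_negf sum_divide_distrib)
  qed
  finally show ?thesis
    by (simp add: sum_negf)
qed

text \<open>Solves \<open>(1 + \<Lambda>) f = g\<close>, where \<open>\<Lambda>\<close> has the off-diagonal entries \<open>x\<^bsup>-d(\<rho>,\<pi>)\<^esup>\<close>.\<close>

lemma path_sum_expansion:
  assumes rec: "\<And>\<rho>. \<rho> \<in> brauer_space k \<Longrightarrow>
      f \<rho> = g \<rho> - (\<Sum>\<pi>\<in>brauer_space k - {\<rho>}. f \<pi> / x ^ brauer_dist k \<rho> \<pi>)"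
    and "\<rho> \<in> brauer_space k"
  shows "f \<rho> = (\<Sum>r<R. path_sum k x g r \<rho>) + path_sum k x f R \<rho>"
proof -
  \<comment> \<open>This is (-\<Lambda>)^r applied to f = g - \<Lambda> f. Summed over r it
    telescopes, leaving an exact remainder, so convergence is not an issue.\<close>
  have step: "path_sum k x f r \<rho> = path_sum k x g r \<rho> + path_sum k x f (Suc r) \<rho>"
    if "\<rho> \<in> brauer_space k" for r \<rho>
    using that
  proof (induction r arbitrary: \<rho>)
    case 0
    then show ?case
      using rec[OF 0] by (simp add: path_sum_0 path_sum_Suc)
  next
    case (Suc r)
    have "path_sum k x f (Suc r) \<rho> = - (\<Sum>\<pi>\<in>brauer_space k - {\<rho>}.
        path_sum k x g r \<pi> / x ^ brauer_dist k \<rho> \<pi> + path_sum k x f (Suc r) \<pi> / x ^ brauer_dist k \<rho> \<pi>)"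
      unfolding path_sum_Suc[OF Suc.prems, of x f r]
      by (intro arg_cong[of _ _ uminus] sum.cong refl)
         (simp add: Suc.IH add_divide_distrib[symmetric])
    then show ?case
      by (simp add: path_sum_Suc[OF Suc.prems] sum.distrib)
  qed
  show ?thesis
  proof (induction R)
    case 0
    then show ?case
      using assms(2) by (simp add: path_sum_0)
  next
    case (Suc R)
    then show ?case
      using step[OF assms(2), of R] unfolding sum.lessThan_Suc by linarith
  qed
qed

section \<open>The leading coefficient\<close>

lemma signed_count_eq:
  assumes "finite (min_paths k a)"
  shows "real_of_int (signed_count k a) = (\<Sum>p\<in>min_paths k a. (-1) ^ path_steps p)"
proof -
  let ?E = "{p \<in> min_paths k a. even (path_steps p)}"
  let ?O = "{p \<in> min_paths k a. odd (path_steps p)}"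
  have "(\<Sum>p\<in>min_paths k a. (-1) ^ path_steps p :: real) = (\<Sum>p\<in>?E \<union> ?O. (-1) ^ path_steps p)"
    by (intro sum.cong) auto
  also have "\<dots> = (\<Sum>p\<in>?E. (-1) ^ path_steps p) + (\<Sum>p\<in>?O. (-1) ^ path_steps p)"
    using assms by (intro sum.union_disjoint) auto
  also have "\<dots> = (\<Sum>p\<in>?E. 1) + (\<Sum>p\<in>?O. -1)"
    by (intro arg_cong2[of _ _ _ _ "(+)"] sum.cong) auto
  finally show ?thesis
    by (simp add: signed_count_def)
qed

lemma min_dist_le_path_length:
  assumes "brauer_path k p" "admissible a p"
  shows "min_dist k a \<le> enat (path_length k p)"
proof -
  have "min_dist k a \<le> enat (brauer_dist k (hd p) (last p))"
    unfolding min_dist_def using assms(2) brauer_path_ends[OF assms(1)]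
    by (intro Inf_lower) (auto simp: admissible_def)
  also have "\<dots> \<le> enat (path_length k p)"
    using brauer_dist_le_path_length[OF assms(1)] by simp
  finally show ?thesis .
qed

text \<open>The asymptotics without any integral. The constant \<open>C\<close> is chosen before
  \<open>x\<close> and \<open>f\<close>, because in the application both depend on n.\<close>

lemma signed_count_approx:
  fixes a :: "nat mat" and c :: real
  assumes e: "min_dist k a = enat e"
  defines "A \<equiv> {\<rho> \<in> brauer_space k. delta \<rho> (left_index a) = 1}"
    and "B \<equiv> {\<rho> \<in> brauer_space k. delta \<rho> (right_index a) = 1}"
  shows "\<exists>C. \<forall>x\<ge>1. \<forall>f.
    (\<forall>\<rho>\<in>brauer_space k. f \<rho> =
      of_bool (\<rho> \<in> B) - (\<Sum>\<pi>\<in>brauer_space k - {\<rho>}. f \<pi> / x ^ brauer_dist k \<rho> \<pi>)) \<longrightarrow>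
    (\<forall>\<rho>\<in>brauer_space k. \<bar>f \<rho>\<bar> \<le> c * x ^ k) \<longrightarrow>
    \<bar>x ^ e * (\<Sum>\<rho>\<in>A. f \<rho>) - of_int (signed_count k a)\<bar> \<le> C / x"
proof -
  \<comment> \<open>Paths with \<open>R\<close> steps have weight at most x^(-R), while
    \<open>f\<close> may be as large as x^k. The choice leaves x^(-e-1).\<close>
  define R where "R = k + Suc e"
  \<comment> \<open>All admissible paths with fewer than \<open>R\<close> steps. A path of length
    \<open>e\<close> has at most \<open>e\<close> steps, so the minimal ones are among them.\<close>
  define Q where "Q = (\<Union>(\<rho>, r)\<in>A \<times> {..<R}. {p \<in> paths_from k \<rho> r. last p \<in> B})"
  define C where "C = real (card Q) + (\<Sum>\<rho>\<in>A. real (card (paths_from k \<rho> R))) * c"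
  have AD: "A \<subseteq> brauer_space k"
    by (auto simp: A_def)
  have finA: "finite A"
    using finite_brauer_space AD by (rule finite_subset[rotated])
  have finQ: "finite Q"
    unfolding Q_def using finA AD by (auto simp: finite_paths_from)
  have Q_eq: "Q = {p. brauer_path k p \<and> admissible a p \<and> path_steps p < R}"
    by (auto simp: Q_def A_def B_def paths_from_def admissible_def brauer_path_ends)
  have min_Q: "min_paths k a \<subseteq> Q"
  proof
    fix p assume p: "p \<in> min_paths k a"
    then have "path_length k p = e"
      using e by (simp add: min_paths_def)
    then have "path_steps p < R"
      using path_steps_le_length[of k p] p by (simp add: min_paths_def R_def)
    then show "p \<in> Q"
      using p by (simp add: Q_eq min_paths_def)
  qed
  \<comment> \<open>Lengths are integers, so every path in \<open>Q\<close> that is not minimal is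
    longer by at least 1; this is the gain of 1/x.\<close>
  have length_Q: "Suc e \<le> path_length k p" if "p \<in> Q - min_paths k a" for p
    using that min_dist_le_path_length[of k p a] e by (auto simp: Q_eq min_paths_def)
  show ?thesis
  proof (intro exI[of _ C] allI impI)
    fix x :: real and f
    assume x: "x \<ge> 1"
      and rec: "\<forall>\<rho>\<in>brauer_space k. f \<rho> =
        of_bool (\<rho> \<in> B) - (\<Sum>\<pi>\<in>brauer_space k - {\<rho>}. f \<pi> / x ^ brauer_dist k \<rho> \<pi>)"
      and bound: "\<forall>\<rho>\<in>brauer_space k. \<bar>f \<rho>\<bar> \<le> c * x ^ k"
    define w where "w = (\<lambda>p. (-1) ^ path_steps p / x ^ path_length k p)"
    define g :: "nat set set \<Rightarrow> real" where "g = (\<lambda>\<rho>. of_bool (\<rho> \<in> B))"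
    have abs_w: "\<bar>w p\<bar> \<le> 1 / x ^ l" if "l \<le> path_length k p" for p l
    proof -
      have "\<bar>w p\<bar> = 1 / x ^ path_length k p"
        using x by (simp add: w_def abs_mult power_abs)
      then show ?thesis
        using x that by (simp add: divide_left_mono power_increasing)
    qed
    have "(\<Sum>\<rho>\<in>A. f \<rho>) = (\<Sum>\<rho>\<in>A. \<Sum>r<R. path_sum k x g r \<rho>) + (\<Sum>\<rho>\<in>A. path_sum k x f R \<rho>)"
      unfolding sum.distrib[symmetric] using rec AD
      by (intro sum.cong refl path_sum_expansion) (auto simp: g_def)
    also have "(\<Sum>\<rho>\<in>A. \<Sum>r<R. path_sum k x g r \<rho>) =
        (\<Sum>(\<rho>, r)\<in>A \<times> {..<R}. \<Sum>p\<in>{p \<in> paths_from k \<rho> r. last p \<in> B}. w p)"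
      unfolding sum.cartesian_product
    proof (intro sum.cong refl, clarify)
      fix \<rho> r assume "\<rho> \<in> A"
      then have fin: "finite (paths_from k \<rho> r)"
        using AD by (intro finite_paths_from) auto
      have "path_sum k x g r \<rho> = (\<Sum>p\<in>paths_from k \<rho> r. if last p \<in> B then w p else 0)"
        unfolding path_sum_def by (intro sum.cong refl) (auto simp: g_def w_def paths_from_def)
      also have "\<dots> = (\<Sum>p\<in>{p \<in> paths_from k \<rho> r. last p \<in> B}. w p)"
        by (rule sum.inter_filter[OF fin, symmetric])
      finally show "path_sum k x g r \<rho> = (\<Sum>p\<in>{p \<in> paths_from k \<rho> r. last p \<in> B}. w p)" .
    qed
    also have "\<dots> = (\<Sum>z\<in>A \<times> {..<R}. \<Sum>p\<in>(case z of (\<rho>, r) \<Rightarrow> {p \<in> paths_from k \<rho> r. last p \<in> B}). w p)"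
      by (intro sum.cong) auto
    \<comment> \<open>A path determines its start and its number of steps, so the union is
      disjoint.\<close>
    also have "\<dots> = (\<Sum>p\<in>Q. w p)"
      unfolding Q_def using finA AD
      by (intro sum.UNION_disjoint[symmetric])
         (auto simp: finite_paths_from, auto simp: paths_from_def)
    also have "\<dots> = (\<Sum>p\<in>Q - min_paths k a. w p) + (\<Sum>p\<in>min_paths k a. w p)"
      using sum.subset_diff[OF min_Q finQ] .
    also have "(\<Sum>p\<in>min_paths k a. w p) = of_int (signed_count k a) / x ^ e"
      unfolding signed_count_eq[OF finite_subset[OF min_Q finQ]] sum_divide_distrib
      using e by (intro sum.cong) (auto simp: w_def min_paths_def)
    finally have eq: "x ^ e * (\<Sum>\<rho>\<in>A. f \<rho>) - of_int (signed_count k a) =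
        x ^ e * ((\<Sum>p\<in>Q - min_paths k a. w p) + (\<Sum>\<rho>\<in>A. path_sum k x f R \<rho>))"
      using x by (simp add: algebra_simps)
    have "\<bar>\<Sum>p\<in>Q - min_paths k a. w p\<bar> \<le> (\<Sum>p\<in>Q - min_paths k a. 1 / x ^ Suc e)"
      by (intro order_trans[OF sum_abs] sum_mono abs_w length_Q)
    also have "\<dots> \<le> (\<Sum>p\<in>Q. 1 / x ^ Suc e)"
      using x finQ by (intro sum_mono2) auto
    finally have 1: "\<bar>\<Sum>p\<in>Q - min_paths k a. w p\<bar> \<le> real (card Q) / x ^ Suc e"
      by simp
    have "\<bar>path_sum k x f R \<rho>\<bar> \<le> real (card (paths_from k \<rho> R)) * c / x ^ Suc e" if "\<rho> \<in> A" for \<rho>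
    proof -
      have "\<bar>(-1) ^ R / x ^ path_length k p * f (last p)\<bar> \<le> c / x ^ Suc e"
        if p: "p \<in> paths_from k \<rho> R" for p
      proof -
        have path: "brauer_path k p" "path_steps p = R"
          using p by (auto simp: paths_from_def)
        have "\<bar>w p\<bar> \<le> 1 / x ^ R"
          using path_steps_le_length[OF path(1)] path(2) by (intro abs_w) simp
        moreover have "\<bar>f (last p)\<bar> \<le> c * x ^ k"
          using brauer_path_ends(2)[OF path(1)] bound by blast
        ultimately have "\<bar>w p\<bar> * \<bar>f (last p)\<bar> \<le> 1 / x ^ R * (c * x ^ k)"
          using x by (intro mult_mono) auto
        also have "\<dots> = c / x ^ Suc e"
          using x by (simp add: R_def power_add)
        finally show ?thesis
          by (simp add: w_def path(2) abs_mult)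
      qed
      then have "\<bar>path_sum k x f R \<rho>\<bar> \<le> (\<Sum>p\<in>paths_from k \<rho> R. c / x ^ Suc e)"
        unfolding path_sum_def by (intro order_trans[OF sum_abs] sum_mono)
      then show ?thesis
        by simp
    qed
    then have "\<bar>\<Sum>\<rho>\<in>A. path_sum k x f R \<rho>\<bar> \<le> (\<Sum>\<rho>\<in>A. real (card (paths_from k \<rho> R)) * c / x ^ Suc e)"
      by (intro order_trans[OF sum_abs] sum_mono)
    also have "\<dots> = (\<Sum>\<rho>\<in>A. real (card (paths_from k \<rho> R))) * c / x ^ Suc e"
      by (simp add: sum_distrib_right sum_divide_distrib)
    finally have "\<bar>(\<Sum>p\<in>Q - min_paths k a. w p) + (\<Sum>\<rho>\<in>A. path_sum k x f R \<rho>)\<bar> \<le> C / x ^ Suc e"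
      using 1 by (simp add: C_def add_divide_distrib)
    then have "x ^ e * \<bar>(\<Sum>p\<in>Q - min_paths k a. w p) + (\<Sum>\<rho>\<in>A. path_sum k x f R \<rho>)\<bar>
        \<le> x ^ e * (C / x ^ Suc e)"
      using x by (intro mult_left_mono) auto
    then show "\<bar>x ^ e * (\<Sum>\<rho>\<in>A. f \<rho>) - of_int (signed_count k a)\<bar> \<le> C / x"
      unfolding eq abs_mult using x by simp
  qed
qed

subsection \<open>The estimate\<close>

text \<open>The left and the right index read in parallel, so that a product over positions can be
  regrouped by matrix entries.\<close>

definition index_pairs :: "nat mat \<Rightarrow> (nat \<times> nat) list" where
  "index_pairs a = concat (map (\<lambda>i. concat (map (\<lambda>j. replicate (a $$ (i, j)) (i, j))
     [0..<dim_col a])) [0..<dim_row a])"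

lemma left_index_eq: "left_index a = map fst (index_pairs a)"
  by (simp add: left_index_def index_pairs_def map_concat o_def map_replicate_const)

lemma right_index_eq: "right_index a = map snd (index_pairs a)"
  by (simp add: right_index_def index_pairs_def map_concat o_def map_replicate_const)

lemma length_index_pairs: "length (index_pairs a) = entry_sum a"
  by (simp add: index_pairs_def entry_sum_def length_concat o_def
      sum_list_distinct_conv_sum_set lessThan_atLeast0)

lemma set_index_pairs: "set (index_pairs a) \<subseteq> {..<dim_row a} \<times> {..<dim_col a}"
  by (auto simp: index_pairs_def)

lemma prod_list_map_concat:
  fixes f :: "'a \<Rightarrow> 'b::comm_monoid_mult"
  shows "prod_list (map f (concat (map g [0..<m]))) = (\<Prod>i<m. prod_list (map f (g i)))"
  by (induction m) simp_all

lemma prod_index_pairs: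
  fixes f :: "nat \<times> nat \<Rightarrow> 'b::comm_monoid_mult"
  shows "(\<Prod>s<entry_sum a. f (index_pairs a ! s)) =
    (\<Prod>i<dim_row a. \<Prod>j<dim_col a. f (i, j) ^ (a $$ (i, j)))"
proof -
  have "(\<Prod>s<entry_sum a. f (index_pairs a ! s)) = prod_list (map f (index_pairs a))"
    by (simp add: prod.list_conv_set_nth length_index_pairs lessThan_atLeast0)
  also have "\<dots> = (\<Prod>i<dim_row a. \<Prod>j<dim_col a. f (i, j) ^ (a $$ (i, j)))"
    by (simp add: index_pairs_def prod_list_map_concat prod_list_replicate)
  finally show ?thesis .
qed

lemma index_less:
  assumes "a \<in> carrier_mat p q"
  shows "(!) (left_index a) \<in> {..<entry_sum a} \<rightarrow> {..<p}"
    and "(!) (right_index a) \<in> {..<entry_sum a} \<rightarrow> {..<q}"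
proof -
  have "index_pairs a ! s \<in> {..<p} \<times> {..<q}" if "s < entry_sum a" for s
    using that set_index_pairs[of a] nth_mem[of s "index_pairs a"] assms
    by (auto simp: length_index_pairs)
  then show "(!) (left_index a) \<in> {..<entry_sum a} \<rightarrow> {..<p}"
    and "(!) (right_index a) \<in> {..<entry_sum a} \<rightarrow> {..<q}"
    by (fastforce simp: left_index_eq right_index_eq length_index_pairs mem_Times_iff)+
qed

lemma orth_integral_eq_moment:
  "orth_integral M a = moment M (entry_sum a) ((!) (left_index a)) ((!) (right_index a))"
proof -
  have "(\<Prod>s<entry_sum a. u $$ (left_index a ! s, right_index a ! s)) =
      (\<Prod>i<dim_row a. \<Prod>j<dim_col a. u $$ (i, j) ^ (a $$ (i, j)))" for u :: "real mat"
    unfolding prod_index_pairs[of "\<lambda>x. u $$ x", symmetric]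
    by (intro prod.cong) (auto simp: left_index_eq right_index_eq length_index_pairs)
  then show ?thesis
    by (simp add: orth_integral_def moment_def)
qed

context orth_haar_measure
begin

lemma moment_eq_0:
  assumes i: "i \<in> {..<2 * k} \<rightarrow> {..<n}" and j: "j \<in> {..<2 * k} \<rightarrow> {..<n}"
    and none: "\<not> (\<exists>\<pi>\<in>brauer_space k. block_const \<pi> i)"
  shows "moment M (2 * k) i j = 0"
  using even_fibres_imp_pairing[of "{..<2 * k}" i] none moment_odd_eq_0[OF i j]
  by (auto simp: brauer_space_eq)

text \<open>An infinite minimum means that one of the two indices is compatible with no pairing. The
  parity argument then also covers n \<le> 2k, where the expansion over pairings is not at
  hand.\<close>

lemma orth_integral_eq_0:
  assumes a: "a \<in> carrier_mat p q" "entry_sum a = 2 * k" and n: "n \<ge> max p q"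
    and e: "min_dist k a = \<infinity>"
  shows "orth_integral M a = 0"
proof -
  have i: "(!) (left_index a) \<in> {..<2 * k} \<rightarrow> {..<n}" and j: "(!) (right_index a) \<in> {..<2 * k} \<rightarrow> {..<n}"
    using index_less[OF a(1)] n by (auto simp: a(2) Pi_def)
  have "\<not> (\<exists>\<pi>\<in>brauer_space k. block_const \<pi> ((!) (left_index a))) \<or>
      \<not> (\<exists>\<sigma>\<in>brauer_space k. block_const \<sigma> ((!) (right_index a)))"
  proof (rule ccontr)
    assume "\<not> ?thesis"
    then obtain \<pi> \<sigma> where "\<pi> \<in> brauer_space k" "block_const \<pi> ((!) (left_index a))"
      "\<sigma> \<in> brauer_space k" "block_const \<sigma> ((!) (right_index a))"
      by blast
    then have "min_dist k a \<le> enat (brauer_dist k \<pi> \<sigma>)"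
      unfolding min_dist_def by (intro Inf_lower) (auto simp: delta_eq)
    then show False
      using e by simp
  qed
  then show ?thesis
    unfolding orth_integral_eq_moment a(2)
    using moment_eq_0[OF i j] moment_eq_0[OF j i] moment_commute[OF i j] by auto
qed

text \<open>Here \<open>f\<close> is n^k W applied to the indicator of \<open>B\<close>. The factor
  n^k normalizes the diagonal of the Gram matrix to 1, so the Gram relation becomes the recursion (1
  + \<Lambda>) f = \<open>of_bool (\<rho> \<in> B)\<close>.\<close>

lemma orth_integral_approx:
  assumes a: "a \<in> carrier_mat p q" "entry_sum a = 2 * k" and n: "n \<ge> max p q" "n > 2 * k"
  defines "A \<equiv> {\<rho> \<in> brauer_space k. delta \<rho> (left_index a) = 1}"
    and "B \<equiv> {\<rho> \<in> brauer_space k. delta \<rho> (right_index a) = 1}"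
  obtains f where
    "\<forall>\<rho>\<in>brauer_space k. f \<rho> =
      of_bool (\<rho> \<in> B) - (\<Sum>\<pi>\<in>brauer_space k - {\<rho>}. f \<pi> / real n ^ brauer_dist k \<rho> \<pi>)"
    "\<forall>\<rho>\<in>brauer_space k. \<bar>f \<rho>\<bar> \<le> real (card (brauer_space k)) * real n ^ k"
    "real n ^ k * orth_integral M a = (\<Sum>\<rho>\<in>A. f \<rho>)"
proof
  let ?f = "\<lambda>\<rho>. \<Sum>\<tau>\<in>B. real n ^ k * weingarten k \<rho> \<tau>"
  have i: "(!) (left_index a) \<in> {..<2 * k} \<rightarrow> {..<n}" and j: "(!) (right_index a) \<in> {..<2 * k} \<rightarrow> {..<n}"
    using index_less[OF a(1)] n by (auto simp: a(2) Pi_def)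
  have AB: "A = {\<rho> \<in> brauer_space k. block_const \<rho> ((!) (left_index a))}"
    "B = {\<rho> \<in> brauer_space k. block_const \<rho> ((!) (right_index a))}"
    by (auto simp: A_def B_def delta_eq)
  have BD: "B \<subseteq> brauer_space k"
    by (auto simp: B_def)
  have finB: "finite B"
    using finite_brauer_space BD by (rule finite_subset[rotated])
  have n0: "real n > 0"
    using n by simp
  show "real n ^ k * orth_integral M a = (\<Sum>\<rho>\<in>A. ?f \<rho>)"
    unfolding orth_integral_eq_moment a(2) moment_eq_weingarten[OF n(2) i j] AB
    by (simp add: sum_distrib_left)
  show "\<forall>\<rho>\<in>brauer_space k. \<bar>?f \<rho>\<bar> \<le> real (card (brauer_space k)) * real n ^ k"
  proof
    fix \<rho> assume \<rho>: "\<rho> \<in> brauer_space k"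
    have "\<bar>real n ^ k * weingarten k \<rho> \<tau>\<bar> \<le> real n ^ k" if "\<tau> \<in> B" for \<tau>
      using abs_weingarten_le_1[OF n(2) \<rho>, of \<tau>] that BD n0
      by (auto simp: abs_mult mult_left_le)
    then have "\<bar>?f \<rho>\<bar> \<le> (\<Sum>\<tau>\<in>B. real n ^ k)"
      by (intro order_trans[OF sum_abs] sum_mono)
    also have "\<dots> \<le> real (card (brauer_space k)) * real n ^ k"
      using card_mono[OF finite_brauer_space BD] by (simp add: mult_right_mono)
    finally show "\<bar>?f \<rho>\<bar> \<le> real (card (brauer_space k)) * real n ^ k" .
  qed
  show "\<forall>\<rho>\<in>brauer_space k. ?f \<rho> = of_bool (\<rho> \<in> B) -
      (\<Sum>\<pi>\<in>brauer_space k - {\<rho>}. ?f \<pi> / real n ^ brauer_dist k \<rho> \<pi>)"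
  proof
    fix \<rho> assume \<rho>: "\<rho> \<in> brauer_space k"
    \<comment> \<open>By \<open>loops_le\<close> the subtraction in the distance is exact.\<close>
    have loops: "real n ^ loops k \<rho> \<pi> = real n ^ k / real n ^ brauer_dist k \<rho> \<pi>" for \<pi>
      using loops_le[OF \<rho>, of \<pi>] n0 by (simp add: brauer_dist_def power_diff)
    have "real n ^ k * weingarten k \<rho> \<tau> = of_bool (\<rho> = \<tau>) -
        (\<Sum>\<pi>\<in>brauer_space k - {\<rho>}. real n ^ k * weingarten k \<pi> \<tau> / real n ^ brauer_dist k \<rho> \<pi>)"
      if "\<tau> \<in> B" for \<tau>
    proof -
      have "of_bool (\<rho> = \<tau>) = (\<Sum>\<pi>\<in>brauer_space k. real n ^ loops k \<rho> \<pi> * weingarten k \<pi> \<tau>)"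
        using gram_weingarten[OF n(2) \<rho>] that BD by auto
      also have "\<dots> = real n ^ loops k \<rho> \<rho> * weingarten k \<rho> \<tau> +
          (\<Sum>\<pi>\<in>brauer_space k - {\<rho>}. real n ^ loops k \<rho> \<pi> * weingarten k \<pi> \<tau>)"
        by (rule sum.remove[OF finite_brauer_space \<rho>])
      finally show ?thesis
        by (simp add: loops brauer_dist_self[OF \<rho>])
    qed
    then have "?f \<rho> = (\<Sum>\<tau>\<in>B. of_bool (\<rho> = \<tau>)) - (\<Sum>\<tau>\<in>B.
        \<Sum>\<pi>\<in>brauer_space k - {\<rho>}. real n ^ k * weingarten k \<pi> \<tau> / real n ^ brauer_dist k \<rho> \<pi>)"
      by (simp add: sum_subtractf)
    also have "(\<Sum>\<tau>\<in>B. of_bool (\<rho> = \<tau>)) = (\<Sum>\<tau>\<in>B. if \<rho> = \<tau> then 1 else 0 :: real)"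
      by (intro sum.cong) auto
    also have "\<dots> = of_bool (\<rho> \<in> B)"
      using finB by simp
    also have "(\<Sum>\<tau>\<in>B. \<Sum>\<pi>\<in>brauer_space k - {\<rho>}.
        real n ^ k * weingarten k \<pi> \<tau> / real n ^ brauer_dist k \<rho> \<pi>) =
        (\<Sum>\<pi>\<in>brauer_space k - {\<rho>}. ?f \<pi> / real n ^ brauer_dist k \<rho> \<pi>)"
      by (subst sum.swap) (simp add: sum_divide_distrib)
    finally show "?f \<rho> = of_bool (\<rho> \<in> B) -
        (\<Sum>\<pi>\<in>brauer_space k - {\<rho>}. ?f \<pi> / real n ^ brauer_dist k \<rho> \<pi>)" .
  qed
qed

end

theorem theorem5p2:
  fixes p q k :: nat and a :: "nat mat" and haar :: "nat \<Rightarrow> real mat measure"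
  assumes "p > 0" and "q > 0"
    and "a \<in> carrier_mat p q"
    and "even (entry_sum a)"
    and "k = entry_sum a div 2"
    and "\<And>n. n \<ge> max p q \<Longrightarrow> orth_haar n (haar n)"
  shows "\<exists>r :: nat \<Rightarrow> real. r \<in> O(\<lambda>n. 1 / real n) \<and>
    (\<forall>n \<ge> max p q. orth_integral (haar n) a =
       neg_power (real n) (enat k + min_dist k a) * (of_int (signed_count k a) + r n))"
proof -
  have sum: "entry_sum a = 2 * k"
    using assms(4,5) by simp
  have meas: "orth_haar_measure n (haar n)" if "n \<ge> max p q" for n
    using assms(6)[OF that] by unfold_locales
  show ?thesis
  proof (cases "min_dist k a")
    case infinity
    have "orth_integral (haar n) a = 0" if "n \<ge> max p q" for n
      using orth_haar_measure.orth_integral_eq_0[OF meas[OF that] assms(3) sum that infinity] .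
    then show ?thesis
      by (intro exI[of _ "\<lambda>_. 0"]) (simp add: infinity neg_power_def)
  next
    case (enat e)
    \<comment> \<open>Solving the claimed identity for the error defines \<open>r\<close> for all n.
      Only its bound is restricted to n > 2k, which is enough for the asymptotic statement.\<close>
    define r where "r = (\<lambda>n. real n ^ (k + e) * orth_integral (haar n) a - of_int (signed_count k a))"
    from signed_count_approx[OF enat, of "real (card (brauer_space k))"] obtain C where C:
      "\<bar>x ^ e * (\<Sum>\<rho>\<in>{\<rho> \<in> brauer_space k. delta \<rho> (left_index a) = 1}. f \<rho>) -
        of_int (signed_count k a)\<bar> \<le> C / x"
      if "x \<ge> 1" "\<forall>\<rho>\<in>brauer_space k. f \<rho> =
          of_bool (\<rho> \<in> {\<rho> \<in> brauer_space k. delta \<rho> (right_index a) = 1}) -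
          (\<Sum>\<pi>\<in>brauer_space k - {\<rho>}. f \<pi> / x ^ brauer_dist k \<rho> \<pi>)"
        "\<forall>\<rho>\<in>brauer_space k. \<bar>f \<rho>\<bar> \<le> real (card (brauer_space k)) * x ^ k"
      for x f
      by blast
    have bound: "\<bar>r n\<bar> \<le> C / real n" if n: "n \<ge> max p q" "n > 2 * k" for n
    proof -
      obtain f where f:
        "\<forall>\<rho>\<in>brauer_space k. f \<rho> =
          of_bool (\<rho> \<in> {\<rho> \<in> brauer_space k. delta \<rho> (right_index a) = 1}) -
          (\<Sum>\<pi>\<in>brauer_space k - {\<rho>}. f \<pi> / real n ^ brauer_dist k \<rho> \<pi>)"
        "\<forall>\<rho>\<in>brauer_space k. \<bar>f \<rho>\<bar> \<le> real (card (brauer_space k)) * real n ^ k"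
        "real n ^ k * orth_integral (haar n) a =
          (\<Sum>\<rho>\<in>{\<rho> \<in> brauer_space k. delta \<rho> (left_index a) = 1}. f \<rho>)"
        by (rule orth_haar_measure.orth_integral_approx[OF meas[OF n(1)] assms(3) sum n])
      have "r n = real n ^ e * (real n ^ k * orth_integral (haar n) a) - of_int (signed_count k a)"
        by (simp add: r_def power_add)
      also have "\<bar>\<dots>\<bar> \<le> C / real n"
        unfolding f(3) using n by (intro C f(1,2)) simp
      finally show ?thesis .
    qed
    have "eventually (\<lambda>n. norm (r n) \<le> C * norm (1 / real n)) at_top"
      using eventually_ge_at_top[of "max p q"] eventually_gt_at_top[of "2 * k"]
    proof eventually_elim
      case (elim n)
      then show ?case
        using bound[of n] by simp
    qed
    then have "r \<in> O(\<lambda>n. 1 / real n)"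
      by (rule bigoI)
    \<comment> \<open>Since p > 0 also n > 0, so the power of n can be cancelled.\<close>
    moreover have "orth_integral (haar n) a =
        neg_power (real n) (enat k + min_dist k a) * (of_int (signed_count k a) + r n)"
      if "n \<ge> max p q" for n
      using that assms(1) by (simp add: enat neg_power_def r_def)
    ultimately show ?thesis
      by blast
  qed
qed

end
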